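(* Let $n\ge 3$ and let $B_n$ be a bouquet with $n$ edges whose intersection graph $I(B_n)$ is the cycle $C_n$ on $n$ vertices. Then $$^{\partial}\varepsilon_{B_n}^{\times}(z)=\begin{cases}\dfrac{2^{n-1}-1}{3}\,z^{n-2}+2^{n-1}z^{n-1}+\dfrac{2^{n}+1}{3}\,z^{n}, & \text{if } n \text{ is odd},\\[2mm] \dfrac{2^{n-1}+1}{3}\,z^{n-2}+2^{n-1}z^{n-1}+\dfrac{2^{n}-1}{3}\,z^{n}, & \text{if } n \text{ is even}.\end{cases}$$
   Context: A ribbon graph $G$ is a surface with boundary represented as the union of two finite sets of closed topological discs, vertex-discs $V(G)$ and edge-ribbons $E(G)$, such that: vertex-discs and edge-ribbons intersect in disjoint line segments; each such segment lies on the boundary of precisely one vertex-disc and precisely one edge-ribbon; every edge-ribbon contains exactly two such segments. All graphs are connected (loops and multiple edges allowed). Let $F(G)$ be the set of faces (boundary components of the surface) and $c(G)$ the number of connected components. The Euler genus is $\varepsilon(G)=2c(G)-|V(G)|+|E(G)|-|F(G)|$. For $A\subseteq E(G)$, the partial Petrial $G^{\times|A}$ is obtained by detaching one end of each edge-ribbon in $A$ from its incident vertex-disc, giving the edge a half-twist, and reattaching it. The partial Petrial polynomial is $^{\partial}\varepsilon_G^{\times}(z)=\sum_{A\subseteq E(G)}z^{\varepsilon(G^{\times|A})}$. A bouquet is a ribbon graph with exactly one vertex-disc. Two edges (loops) of a bouquet are interlaced if their half-edges alternate in the cyclic order of half-edges around the vertex-disc. The intersection graph $I(B)$ of a bouquet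 $B$ has the loops of $B$ as vertices, two being adjacent if and only if the loops are interlaced. *)

theory Defs
  imports "HOL-Computational_Algebra.Polynomial"
begin

text \<open>
  Ribbon graphs are represented, up to homeomorphism, by their gluing data.
  Vertex-discs and edge-ribbons meet in disjoint line segments; a flag is an endpoint
  of such a segment.  Every flag \<open>x\<close> is joined to exactly one other flag by each of three
  kinds of arc:
    \<^item> \<open>seg x\<close>: the other end of the line segment at \<open>x\<close>;
    \<^item> \<open>side x\<close>: the other end of the arc at \<open>x\<close> in which the boundary of the edge-ribbon
      runs outside its two segments;
    \<^item> \<open>arc x\<close>: the other end of the arc at \<open>x\<close> in which the boundary of the vertex-disc
      runs outside the segments.
  The boundary circle of a vertex-disc alternates \<open>seg\<close> and \<open>arc\<close>, that of an edge-ribbon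
  alternates \<open>seg\<close> and \<open>side\<close>, and a boundary component of the surface alternates \<open>side\<close>
  and \<open>arc\<close>.  A vertex-disc that meets no edge-ribbon carries no flag; such discs are counted
  by \<open>isolated\<close>, and each of them is also a connected component with one face.
\<close>

record 'a ribbon_graph =
  flags :: "'a set"
  seg :: "'a \<Rightarrow> 'a"
  side :: "'a \<Rightarrow> 'a"
  arc :: "'a \<Rightarrow> 'a"
  isolated :: nat

definition fpf_involution_on :: "'a set \<Rightarrow> ('a \<Rightarrow> 'a) \<Rightarrow> bool" where
  "fpf_involution_on S f \<longleftrightarrow> (\<forall>x\<in>S. f x \<in> S \<and> f x \<noteq> x \<and> f (f x) = x)"

text \<open>The last two conditions say that each edge-ribbon has exactly four flags, i.e. exactly
  two segments, and that each of its two sides joins one segment to the other.\<close>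

definition is_ribbon_graph :: "'a ribbon_graph \<Rightarrow> bool" where
  "is_ribbon_graph G \<longleftrightarrow>
     finite (flags G) \<and>
     fpf_involution_on (flags G) (seg G) \<and>
     fpf_involution_on (flags G) (side G) \<and>
     fpf_involution_on (flags G) (arc G) \<and>
     (\<forall>x\<in>flags G. side G x \<noteq> seg G x) \<and>
     (\<forall>x\<in>flags G. side G (seg G x) = seg G (side G x))"

definition orbits :: "'a set \<Rightarrow> ('a \<Rightarrow> 'a) set \<Rightarrow> 'a set set" where
  "orbits S fs = S // {(x, f x) | x f. x \<in> S \<and> f \<in> fs}\<^sup>*"

definition edges :: "'a ribbon_graph \<Rightarrow> 'a set set" where
  "edges G = orbits (flags G) {seg G, side G}"

definition num_vertices :: "'a ribbon_graph \<Rightarrow> nat" where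
  "num_vertices G = card (orbits (flags G) {seg G, arc G}) + isolated G"

definition num_faces :: "'a ribbon_graph \<Rightarrow> nat" where
  "num_faces G = card (orbits (flags G) {side G, arc G}) + isolated G"

definition num_components :: "'a ribbon_graph \<Rightarrow> nat" where
  "num_components G = card (orbits (flags G) {seg G, side G, arc G}) + isolated G"

definition euler_genus :: "'a ribbon_graph \<Rightarrow> int" where
  "euler_genus G = 2 * int (num_components G) - int (num_vertices G)
     + int (card (edges G)) - int (num_faces G)"

text \<open>Detaching one end of an edge-ribbon and reattaching it after a half-twist exchanges
  the two ends of that segment, so a side that ran from \<open>x\<close> to \<open>side G x\<close> now runs
  from \<open>x\<close> to \<open>seg G (side G x)\<close>.  Here \<open>A\<close> is a set of edges, i.e. of sets of flags.\<close>

definition partial_petrial :: "'a ribbon_graph \<Rightarrow> 'a set set \<Rightarrow> 'a ribbon_graph" where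
  "partial_petrial G A =
     G\<lparr>side := (\<lambda>x. if x \<in> \<Union>A then seg G (side G x) else side G x)\<rparr>"

text \<open>The Euler genus of a ribbon graph is never negative, so \<open>nat\<close> does not truncate.\<close>

definition partial_petrial_polynomial :: "'a ribbon_graph \<Rightarrow> rat poly" where
  "partial_petrial_polynomial G =
     (\<Sum>A\<in>Pow (edges G). monom 1 (nat (euler_genus (partial_petrial G A))))"

definition bouquet :: "'a ribbon_graph \<Rightarrow> bool" where
  "bouquet G \<longleftrightarrow> is_ribbon_graph G \<and> num_vertices G = 1"

text \<open>Half-edges at a vertex-disc are its segments \<open>{x, seg G x}\<close>.  Crossing the segment at
  \<open>x\<close> and then following the boundary of the disc leads to the next half-edge, so the powers
  of \<open>next_half_edge G\<close> list the half-edges in cyclic order, each exactly once until \<open>x\<close>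
  itself recurs.  (Starting from \<open>seg G x\<close> gives the reverse cyclic order.)\<close>

definition next_half_edge :: "'a ribbon_graph \<Rightarrow> 'a \<Rightarrow> 'a" where
  "next_half_edge G x = arc G (seg G x)"

definition interlaced :: "'a ribbon_graph \<Rightarrow> 'a set \<Rightarrow> 'a set \<Rightarrow> bool" where
  "interlaced G e f \<longleftrightarrow>
     (\<exists>x i j k. 0 < i \<and> i < j \<and> j < k \<and>
        (\<forall>m. 0 < m \<and> m \<le> k \<longrightarrow> (next_half_edge G ^^ m) x \<noteq> x) \<and>
        x \<in> e \<and> (next_half_edge G ^^ i) x \<in> f \<and>
        (next_half_edge G ^^ j) x \<in> e \<and> (next_half_edge G ^^ k) x \<in> f)"

text \<open>A simple graph is a pair of a vertex set and a set of two-element sets of vertices.\<close>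

type_synonym 'v sgraph = "'v set \<times> 'v set set"

definition intersection_graph :: "'a ribbon_graph \<Rightarrow> 'a set sgraph" where
  "intersection_graph G =
     (edges G, {{e, f} | e f. e \<in> edges G \<and> f \<in> edges G \<and> interlaced G e f})"

definition cycle_graph :: "nat \<Rightarrow> nat sgraph" where
  "cycle_graph n = ({..<n}, {{i, (i + 1) mod n} | i. i < n})"

definition sgraph_iso :: "'v sgraph \<Rightarrow> 'w sgraph \<Rightarrow> bool" where
  "sgraph_iso H K \<longleftrightarrow>
     (\<exists>\<phi>. bij_betw \<phi> (fst H) (fst K) \<and>
        (\<forall>u\<in>fst H. \<forall>v\<in>fst H. {u, v} \<in> snd H \<longleftrightarrow> {\<phi> u, \<phi> v} \<in> snd K))"

end

theory Submission imports Defs begin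

text \<open>
  A face is an orbit of flags, so \<open>2 ^ f\<close>, for \<open>f\<close> the number of faces, counts the sets of flags
  that are unions of faces (\<open>card_invariant_sets\<close>).  Regard such a set as a two-colouring of the
  flags and walk once around the vertex-disc of a bouquet.  The colour does not change along the
  arcs between segments, and it changes at both segments of an edge or at neither.  A colouring
  is therefore given by the set \<open>h\<close> of edges at which it changes, together with the colour of one
  flag.  Every \<open>h\<close> closes up, because each edge is crossed twice.  What remains is the requirement
  that the two ends of each side of an edge \<open>e\<close> have the same colour.  The part of the walk
  between them meets one segment of each edge interlaced with \<open>e\<close>, none or both segments of every
  other edge, and one segment of \<open>e\<close> itself if \<open>e\<close> is twisted, or else both or none.  So the
  requirement is one linear equation over the field with two elements for each \<open>e\<close>, and \<open>h\<close> ranges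
  over the kernel of the adjacency matrix of the intersection graph, with ones on the diagonal at
  the twisted edges.  Thus \<open>2 ^ f\<close> is twice the size of that kernel (\<open>two_power_num_faces\<close>), and the
  Euler genus is the rank of the matrix.

  Twisting the edges in \<open>A\<close> flips the diagonal entries at \<open>A\<close> (\<open>twisted_partial_petrial\<close>).  Whatever
  the twists of the given bouquet, the sum over all \<open>A\<close> is thus a sum over all diagonals.

  When the intersection graph is a cycle, a kernel vector \<open>x\<close> satisfies
  \<open>x (i + 1) = x (i - 1) + d i * x i\<close>, so it is determined by two neighbouring entries, and the
  pairs that close up are the fixed points of a product of \<open>n\<close> matrices, each one of two
  elements \<open>S\<close> and \<open>R\<close> of the group of invertible \<open>2 \<times> 2\<close> matrices (\<open>card_cyclic_kernel\<close>).  This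
  group is the symmetric group on the three nonzero vectors, \<open>S\<close> being a transposition and \<open>R\<close> a
  3-cycle.  In its group algebra, \<open>(S + R) ^ n\<close> is a multiple of the sum of all six elements plus
  a remainder that depends only on the parity of \<open>n\<close> (\<open>sum_transfer\<close>).  The identity fixes four
  vectors, a transposition two and a 3-cycle one; these contribute to the powers
  \<open>n - 2\<close>, \<open>n - 1\<close> and \<open>n\<close> respectively, which gives the coefficients.
\<close>

section \<open>Counting orbits by invariant sets\<close>

definition invariant_sets :: "'a set \<Rightarrow> ('a \<Rightarrow> 'a) set \<Rightarrow> 'a set set" where
  "invariant_sets S fs = {U. U \<subseteq> S \<and> (\<forall>x\<in>S. \<forall>f\<in>fs. f x \<in> U \<longleftrightarrow> x \<in> U)}"

lemma invariant_setsI: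
  "U \<subseteq> S \<Longrightarrow> (\<And>x f. x \<in> S \<Longrightarrow> f \<in> fs \<Longrightarrow> f x \<in> U \<longleftrightarrow> x \<in> U) \<Longrightarrow> U \<in> invariant_sets S fs"
  by (simp add: invariant_sets_def)

text \<open>The invariant sets are the unions of orbits.  Since the generators are involutions, the
  reflexive transitive closure that defines the orbits is symmetric, hence an equivalence.\<close>

lemma card_invariant_sets:
  assumes fin: "finite S" and inv: "\<And>f. f \<in> fs \<Longrightarrow> fpf_involution_on S f"
  shows "card (invariant_sets S fs) = 2 ^ card (orbits S fs)"
proof -
  define r where "r = {(x, f x) | x f. x \<in> S \<and> f \<in> fs}"
  have orb: "orbits S fs = (\<lambda>x. r\<^sup>* `` {x}) ` S"
    by (auto simp: orbits_def quotient_def r_def)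
  have "sym r"
  proof (rule symI)
    fix x y assume "(x, y) \<in> r"
    then obtain f where "x \<in> S" "f \<in> fs" "y = f x" by (auto simp: r_def)
    with inv[of f] have "y \<in> S" "x = f y" by (auto simp: fpf_involution_on_def)
    with \<open>f \<in> fs\<close> show "(y, x) \<in> r" unfolding r_def by blast
  qed
  then have sym: "sym (r\<^sup>*)" by (rule sym_rtrancl)
  have closed: "y \<in> U \<longleftrightarrow> x \<in> U" if U: "U \<in> invariant_sets S fs" and "(x, y) \<in> r\<^sup>*" for U x y
    using that(2) by induction (use U in \<open>auto simp: r_def invariant_sets_def\<close>)
  have S: "S \<in> invariant_sets S fs"
    using inv by (auto simp: invariant_sets_def fpf_involution_on_def)
  have eq: "r\<^sup>* `` {x} = r\<^sup>* `` {y}" if "(x, y) \<in> r\<^sup>*" for x y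
    using that sym by (auto dest: symD intro: rtrancl_trans)
  have "bij_betw (\<lambda>U. {C \<in> orbits S fs. C \<subseteq> U}) (invariant_sets S fs) (Pow (orbits S fs))"
  proof (rule bij_betw_byWitness[where f' = Union])
    show "\<forall>U\<in>invariant_sets S fs. \<Union>{C \<in> orbits S fs. C \<subseteq> U} = U"
    proof
      fix U assume U: "U \<in> invariant_sets S fs"
      have "x \<in> \<Union>{C \<in> orbits S fs. C \<subseteq> U}" if "x \<in> U" for x
      proof -
        have "r\<^sup>* `` {x} \<in> orbits S fs"
          using U that by (auto simp: orb invariant_sets_def)
        moreover have "r\<^sup>* `` {x} \<subseteq> U" using closed[OF U] that by auto
        ultimately show ?thesis by blast
      qed
      then show "\<Union>{C \<in> orbits S fs. C \<subseteq> U} = U" by auto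
    qed
    show "\<forall>\<C>\<in>Pow (orbits S fs). {C \<in> orbits S fs. C \<subseteq> \<Union>\<C>} = \<C>"
    proof
      fix \<C> assume \<C>: "\<C> \<in> Pow (orbits S fs)"
      have "C \<in> \<C>" if C: "C \<in> orbits S fs" "C \<subseteq> \<Union>\<C>" for C
      proof -
        obtain x where x: "x \<in> S" "C = r\<^sup>* `` {x}" using C(1) by (auto simp: orb)
        then have "x \<in> \<Union>\<C>" using C(2) by blast
        then obtain D where D: "D \<in> \<C>" "x \<in> D" by blast
        then obtain y where "D = r\<^sup>* `` {y}" using \<C> by (auto simp: orb)
        then have "C = D" using D(2) eq x(2) by auto
        then show ?thesis using D by simp
      qed
      then show "{C \<in> orbits S fs. C \<subseteq> \<Union>\<C>} = \<C>" using \<C> by auto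
    qed
    show "(\<lambda>U. {C \<in> orbits S fs. C \<subseteq> U}) ` invariant_sets S fs \<subseteq> Pow (orbits S fs)" by auto
    show "Union ` Pow (orbits S fs) \<subseteq> invariant_sets S fs"
    proof clarify
      fix \<C> assume \<C>: "\<C> \<subseteq> orbits S fs"
      have mem: "y \<in> \<Union>\<C>" if x: "x \<in> \<Union>\<C>" and xy: "(x, y) \<in> r\<^sup>*" for x y
      proof -
        obtain C where "C \<in> \<C>" "x \<in> C" using x by blast
        moreover from this obtain w where "C = r\<^sup>* `` {w}" using \<C> by (auto simp: orb)
        ultimately have "y \<in> C" using xy by (auto dest: rtrancl_trans)
        then show ?thesis using \<open>C \<in> \<C>\<close> by blast
      qed
      have "\<Union>\<C> \<subseteq> S"
      proof
        fix y assume "y \<in> \<Union>\<C>"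
        then obtain w where "w \<in> S" "(w, y) \<in> r\<^sup>*" using \<C> by (auto simp: orb)
        then show "y \<in> S" using closed[OF S] by blast
      qed
      moreover have "f x \<in> \<Union>\<C> \<longleftrightarrow> x \<in> \<Union>\<C>" if "x \<in> S" "f \<in> fs" for x f
      proof -
        have "(x, f x) \<in> r\<^sup>*" using that by (auto simp: r_def)
        then show ?thesis using mem sym by (meson symD)
      qed
      ultimately show "\<Union>\<C> \<in> invariant_sets S fs" unfolding invariant_sets_def by blast
    qed
  qed
  then have "card (invariant_sets S fs) = card (Pow (orbits S fs))" by (rule bij_betw_same_card)
  then show ?thesis using fin by (simp add: card_Pow orb)
qed

section \<open>Edges as sets of four flags\<close>

definition edge_of :: "'a ribbon_graph \<Rightarrow> 'a \<Rightarrow> 'a set" where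
  "edge_of G x = {x, seg G x, side G x, seg G (side G x)}"

context
  fixes G :: "'a ribbon_graph"
  assumes G: "is_ribbon_graph G"
begin

lemma flags_closed:
  assumes "x \<in> flags G"
  shows "seg G x \<in> flags G" "side G x \<in> flags G" "arc G x \<in> flags G"
    "seg G (seg G x) = x" "side G (side G x) = x" "arc G (arc G x) = x"
    "seg G x \<noteq> x" "side G x \<noteq> x" "arc G x \<noteq> x" "side G x \<noteq> seg G x"
    "side G (seg G x) = seg G (side G x)"
  using G assms by (auto simp: is_ribbon_graph_def fpf_involution_on_def)

lemma edge_of_subset: "x \<in> flags G \<Longrightarrow> edge_of G x \<subseteq> flags G"
  by (auto simp: edge_of_def flags_closed)

lemma edge_of_eq: "x \<in> flags G \<Longrightarrow> y \<in> edge_of G x \<Longrightarrow> edge_of G y = edge_of G x"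
  by (auto simp: edge_of_def flags_closed)

lemma edges_eq: "edges G = edge_of G ` flags G"
proof -
  define r where "r = {(x, f x) | x f. x \<in> flags G \<and> f \<in> {seg G, side G}}"
  have "r\<^sup>* `` {x} = edge_of G x" if x: "x \<in> flags G" for x
  proof -
    have "y \<in> edge_of G x" if "(x, y) \<in> r\<^sup>*" for y
      using that
    proof induction
      case base
      then show ?case by (simp add: edge_of_def)
    next
      case (step y z)
      then show ?case using x by (auto simp: r_def edge_of_def flags_closed)
    qed
    moreover have "(x, seg G x) \<in> r" "(x, side G x) \<in> r" "(side G x, seg G (side G x)) \<in> r"
      using x flags_closed(2)[OF x] by (auto simp: r_def)
    then have "(x, seg G x) \<in> r\<^sup>*" "(x, side G x) \<in> r\<^sup>*" "(x, seg G (side G x)) \<in> r\<^sup>*"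
      by (blast intro: rtrancl_into_rtrancl)+
    then have "edge_of G x \<subseteq> r\<^sup>* `` {x}"
      by (simp add: edge_of_def)
    ultimately show ?thesis by blast
  qed
  then show ?thesis by (auto simp: edges_def orbits_def quotient_def r_def)
qed

lemma edge_eq_edge_of: "e \<in> edges G \<Longrightarrow> x \<in> e \<Longrightarrow> x \<in> flags G \<and> e = edge_of G x"
proof -
  assume "e \<in> edges G" "x \<in> e"
  then obtain y where "y \<in> flags G" "e = edge_of G y" by (auto simp: edges_eq)
  then show ?thesis using edge_of_eq[of y x] edge_of_subset[of y] \<open>x \<in> e\<close> by auto
qed

lemma finite_edges: "finite (edges G)"
  using G by (simp add: edges_eq is_ribbon_graph_def)

end

section \<open>Walking around the vertex-disc of a bouquet\<close>

text \<open>A base flag fixes both a starting point on the boundary of the vertex-disc and a direction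
  of travel.\<close>

locale based_bouquet =
  fixes G :: "'a ribbon_graph" and x0 :: 'a
  assumes bouquet: "bouquet G" and base: "x0 \<in> flags G"
begin

lemma ribbon: "is_ribbon_graph G" using bouquet by (simp add: bouquet_def)

lemmas fc = flags_closed[OF ribbon]

lemma finite_flags: "finite (flags G)" using ribbon by (simp add: is_ribbon_graph_def)

lemma involutions:
  "f \<in> {seg G, side G, arc G} \<Longrightarrow> fpf_involution_on (flags G) f"
  using ribbon by (auto simp: is_ribbon_graph_def)

lemma orbit_count_pos: "card (orbits (flags G) fs) > 0"
proof -
  have "orbits (flags G) fs \<noteq> {}" "finite (orbits (flags G) fs)"
    using base finite_flags by (auto simp: orbits_def quotient_def)
  then show ?thesis by (simp add: card_gt_0_iff)
qed

lemma isolated_eq: "isolated G = 0" and one_vertex: "card (orbits (flags G) {seg G, arc G}) = 1"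
proof -
  have "card (orbits (flags G) {seg G, arc G}) + isolated G = 1"
    using bouquet by (simp add: bouquet_def num_vertices_def)
  then show "isolated G = 0" "card (orbits (flags G) {seg G, arc G}) = 1"
    using orbit_count_pos[of "{seg G, arc G}"] by linarith+
qed

text \<open>This is the form in which the single vertex is used: a property that is preserved by
  \<open>seg\<close> and \<open>arc\<close> and holds at the base flag holds at every flag.\<close>

lemma seg_arc_invariant:
  "U \<in> invariant_sets (flags G) {seg G, arc G} \<Longrightarrow> U = {} \<or> U = flags G"
proof -
  assume U: "U \<in> invariant_sets (flags G) {seg G, arc G}"
  let ?I = "invariant_sets (flags G) {seg G, arc G}"
  have c: "card ?I = 2"
    using card_invariant_sets[of "flags G" "{seg G, arc G}"] finite_flags involutions one_vertex
    by auto
  have sub: "{{}, flags G} \<subseteq> ?I" by (auto simp: invariant_sets_def fc)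
  have "card {{}, flags G} = 2" using base by (auto simp: card_insert_if)
  then have "{{}, flags G} = ?I"
    using c sub card_ge_0_finite[of ?I] by (intro card_subset_eq) simp_all
  then show ?thesis using U by blast
qed

lemma num_components_1: "num_components G = 1"
proof -
  let ?I = "invariant_sets (flags G) {seg G, side G, arc G}"
  have "?I \<subseteq> {{}, flags G}"
  proof
    fix U assume "U \<in> ?I"
    then have "U \<in> invariant_sets (flags G) {seg G, arc G}"
      unfolding invariant_sets_def by blast
    then show "U \<in> {{}, flags G}" using seg_arc_invariant by blast
  qed
  moreover have "{{}, flags G} \<subseteq> ?I" by (auto simp: invariant_sets_def fc)
  ultimately have "?I = {{}, flags G}" by blast
  then have "card ?I = 2" using base by (auto simp: card_insert_if)
  then have "2 ^ card (orbits (flags G) {seg G, side G, arc G}) = (2::nat) ^ 1"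
    using card_invariant_sets[of "flags G" "{seg G, side G, arc G}"] finite_flags involutions
    by auto
  then have "card (orbits (flags G) {seg G, side G, arc G}) = 1"
    by (subst (asm) power_inject_exp) auto
  then show ?thesis by (simp add: num_components_def isolated_eq)
qed

text \<open>The walk in the chosen direction enters its \<open>k\<close>-th segment at \<open>p k\<close> and leaves it at \<open>q k\<close>.
  It closes up after \<open>N\<close> segments.\<close>

definition p :: "nat \<Rightarrow> 'a" where "p k = (next_half_edge G ^^ k) x0"
definition q :: "nat \<Rightarrow> 'a" where "q k = seg G (p k)"

lemma next_closed: "x \<in> flags G \<Longrightarrow> next_half_edge G x \<in> flags G"
  by (simp add: next_half_edge_def fc)

lemma p_0 [simp]: "p 0 = x0" by (simp add: p_def)

lemma p_in [simp]: "p k \<in> flags G"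
  by (induction k) (auto simp: p_def base next_closed)

lemma q_in [simp]: "q k \<in> flags G" by (simp add: q_def fc)

lemma p_Suc: "p (Suc k) = arc G (q k)" by (simp add: p_def q_def next_half_edge_def)

lemma seg_p: "seg G (p k) = q k" and seg_q: "seg G (q k) = p k"
  by (simp_all add: q_def fc)

lemma arc_q: "arc G (q k) = p (Suc k)" and arc_p: "arc G (p (Suc k)) = q k"
  by (simp_all add: p_Suc fc)

lemma next_pow_p: "(next_half_edge G ^^ m) (p k) = p (k + m)"
  by (simp add: p_def funpow_add add.commute[of k])

text \<open>Started at the far end of a segment, the powers of \<open>next_half_edge\<close> run backwards.\<close>

lemma next_pow_q: "(next_half_edge G ^^ m) (q (k + m)) = q k"
proof (induction m)
  case (Suc m)
  have "next_half_edge G (q (k + Suc m)) = q (k + m)"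
    by (simp add: next_half_edge_def seg_q arc_p)
  then show ?case using Suc by (simp only: funpow_Suc_right comp_apply)
qed simp

lemma p_cancel: "p (i + k) = p (j + k) \<Longrightarrow> p i = p j"
proof (induction k)
  case (Suc k)
  then have "q (i + k) = q (j + k)" using arc_p by (metis add_Suc_right)
  then show ?case using Suc.IH seg_q by metis
qed simp

definition N :: nat where "N = (LEAST m. 0 < m \<and> p m = x0)"

lemma N_pos: "0 < N" and p_N: "p N = x0"
proof -
  have "\<not> inj p"
  proof
    assume "inj p"
    moreover have "finite (range p)" by (rule finite_subset[OF _ finite_flags]) auto
    ultimately show False using finite_imageD[of p UNIV] by auto
  qed
  then obtain i j where "i < j" "p i = p j" by (metis injI linorder_neqE_nat)
  then have "p (0 + i) = p ((j - i) + i)" by simp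
  from p_cancel[OF this] have "0 < j - i \<and> p (j - i) = x0" using \<open>i < j\<close> by simp
  then have "0 < N \<and> p N = x0" unfolding N_def by (rule LeastI)
  then show "0 < N" "p N = x0" by auto
qed

lemma p_add_N: "p (k + N) = p k"
proof -
  have "p (k + N) = (next_half_edge G ^^ k) (p N)" by (simp only: next_pow_p add.commute)
  then show ?thesis by (simp only: p_N) (simp only: p_def)
qed

lemma p_mod: "p (k mod N) = p k"
proof -
  have "p (k + m * N) = p k" for k m
  proof (induction m)
    case (Suc m)
    have "k + Suc m * N = (k + m * N) + N" by simp
    then show ?case using Suc p_add_N[of "k + m * N"] by metis
  qed simp
  then show ?thesis by (metis mod_div_mult_eq)
qed

lemma p_eq_iff: "i < N \<Longrightarrow> j < N \<Longrightarrow> p i = p j \<longleftrightarrow> i = j"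
proof -
  have "\<not> (i < j \<and> j < N \<and> p i = p j)" for i j
  proof
    assume a: "i < j \<and> j < N \<and> p i = p j"
    then have "p (0 + i) = p ((j - i) + i)" by simp
    from p_cancel[OF this] have "p (j - i) = x0" by simp
    then have "N \<le> j - i" unfolding N_def using a by (intro Least_le) auto
    then show False using a by linarith
  qed
  then show "i < N \<Longrightarrow> j < N \<Longrightarrow> p i = p j \<longleftrightarrow> i = j" by (metis linorder_neqE_nat)
qed

lemma q_eq_iff: "i < N \<Longrightarrow> j < N \<Longrightarrow> q i = q j \<longleftrightarrow> i = j"
  using p_eq_iff seg_q by metis

text \<open>Were \<open>p (j + d) = q j\<close>, moving both ends inwards would give the same equation with \<open>d\<close> smaller
  by two, ending in a fixed point of \<open>seg\<close> or of \<open>arc\<close>.\<close>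

lemma p_neq_q: "p i \<noteq> q j"
proof -
  have ne: "p (j + d) \<noteq> q j" for j d
  proof (induction d arbitrary: j rule: less_induct)
    case (less d)
    show ?case
    proof
      assume eq: "p (j + d) = q j"
      consider "d = 0" | "d = 1" | m where "d = Suc (Suc m)" by (metis One_nat_def not0_implies_Suc)
      then show False
      proof cases
        case 1 then show False using eq fc(7)[of "p j"] by (simp add: q_def)
      next
        case 2 then show False using eq fc(9)[of "q j"] by (simp add: arc_q)
      next
        case 3
        then have "q (Suc j + m) = p (Suc j)" using eq arc_p arc_q by (metis add_Suc add_Suc_right)
        then have "p (Suc j + m) = q (Suc j)" using seg_q seg_p by metis
        then show False using less[of m "Suc j"] 3 by simp
      qed
    qed
  qed
  \<comment> \<open>Adding a full turn to \<open>i\<close> makes the index on the left the larger one.\<close>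
  have "j mod N \<le> i + N" using N_pos by (meson le_add2 le_trans mod_le_divisor)
  moreover have "q (j mod N) = q j" by (simp add: q_def p_mod)
  ultimately show ?thesis using ne[of "j mod N" "i + N - j mod N"] by (simp add: p_add_N)
qed

lemma flags_eq: "flags G = p ` {..<N} \<union> q ` {..<N}"
proof -
  let ?W = "range p \<union> range q"
  have "?W \<in> invariant_sets (flags G) {seg G, arc G}"
  proof -
    have WF: "?W \<subseteq> flags G" by auto
    have sW: "seg G x \<in> ?W" if "x \<in> ?W" for x using that seg_p seg_q by auto
    have "arc G (p k) \<in> ?W" for k
    proof -
      obtain m where "p k = p (Suc m)" using N_pos p_add_N[of k] by (metis add_gr_0 gr0_conv_Suc)
      then show ?thesis using arc_p by auto
    qed
    then have aW: "arc G x \<in> ?W" if "x \<in> ?W" for x using that arc_q by auto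
    have W_iff: "seg G x \<in> ?W \<longleftrightarrow> x \<in> ?W" "arc G x \<in> ?W \<longleftrightarrow> x \<in> ?W" if x: "x \<in> flags G" for x
    proof -
      show "seg G x \<in> ?W \<longleftrightarrow> x \<in> ?W"
        using sW[of "seg G x", unfolded fc(4)[OF x]] by (rule iffI[OF _ sW])
      show "arc G x \<in> ?W \<longleftrightarrow> x \<in> ?W"
        using aW[of "arc G x", unfolded fc(6)[OF x]] by (rule iffI[OF _ aW])
    qed
    show ?thesis
    proof (rule invariant_setsI[OF WF])
      fix x f assume x: "x \<in> flags G" and "f \<in> {seg G, arc G}"
      then consider "f = seg G" | "f = arc G" by blast
      then show "f x \<in> ?W \<longleftrightarrow> x \<in> ?W" by cases (simp_all only: W_iff[OF x])
    qed
  qed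
  then have "?W = flags G" using seg_arc_invariant[of ?W] by auto
  moreover have "range p = p ` {..<N}"
  proof -
    have "p k \<in> p ` {..<N}" for k
      using p_mod[of k] N_pos by (intro image_eqI[of _ _ "k mod N"]) simp_all
    then show ?thesis by blast
  qed
  moreover from this have "range q = q ` {..<N}"
    unfolding q_def by (metis image_image)
  ultimately show ?thesis by simp
qed

end

section \<open>Interlacement by positions\<close>

text \<open>Modulo two, only the fibres of odd size contribute to the sum over the fibres.\<close>

lemma even_card_vimage:
  assumes "finite h" "finite I"
  shows "even (card {t \<in> I. E t \<in> h}) \<longleftrightarrow> even (card {f \<in> h. odd (card {t \<in> I. E t = f})})"
proof -
  have "{t \<in> I. E t \<in> h} = (\<Union>f\<in>h. {t \<in> I. E t = f})" by blast
  then have "card {t \<in> I. E t \<in> h} = (\<Sum>f\<in>h. card {t \<in> I. E t = f})"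
    using assms by (simp only:) (intro card_UN_disjoint, auto)
  then show ?thesis using assms by (simp only: even_sum_iff)
qed

text \<open>Alternation on a circle with \<open>N\<close> points, expressed in the linear order.  A tour from \<open>s\<close> reaches
  the other point of the first pair at \<open>s + j\<close>, so the stretch from \<open>a\<close> to \<open>b\<close> comes before \<open>s + j\<close>,
  when \<open>s = a\<close>, or after it and past the point \<open>N\<close>, when \<open>s = b\<close>; either way alternation puts
  exactly one point of the second pair there.\<close>

lemma alternating_iff:
  fixes a b c d N :: nat
  assumes "a < b" "b < N" "c < d" "d < N"
    and disj: "{a, b} = {c, d} \<or> {a, b} \<inter> {c, d} = {}"
  shows "(\<exists>s i j k. 0 < i \<and> i < j \<and> j < k \<and> k < N \<and> s < N \<and> s \<in> {a, b} \<and> (s + i) mod N \<in> {c, d} \<and>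
      (s + j) mod N \<in> {a, b} \<and> (s + k) mod N \<in> {c, d})
    \<longleftrightarrow> (a < c \<and> c < b) \<noteq> (a < d \<and> d < b)" (is "?L \<longleftrightarrow> ?R")
proof
  assume ?L
  then obtain s i j k where ijk: "0 < i" "i < j" "j < k" "k < N" "s < N"
    and mem: "s \<in> {a, b}" "(s + i) mod N \<in> {c, d}" "(s + j) mod N \<in> {a, b}" "(s + k) mod N \<in> {c, d}"
    by blast
  have wrap: "s + m = v \<or> s + m = v + N" if "(s + m) mod N = v" "m < N" for m v
    using that ijk(5) by (auto simp: mod_if split: if_splits)
  have s: "s = a \<or> s = b" using mem by simp
  have i: "s + i = c \<or> s + i = d \<or> s + i = c + N \<or> s + i = d + N"
    using mem(2) wrap[of i c] wrap[of i d] ijk by force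
  have j: "s + j = a \<or> s + j = b \<or> s + j = a + N \<or> s + j = b + N"
    using mem(3) wrap[of j a] wrap[of j b] ijk by force
  have k: "s + k = c \<or> s + k = d \<or> s + k = c + N \<or> s + k = d + N"
    using mem(4) wrap[of k c] wrap[of k d] ijk by force
  have sj: "s = a \<and> s + j = b \<or> s = b \<and> s + j = a + N"
    using s j by (elim disjE) (use ijk assms(1-4) in \<open>simp_all\<close>)
  have "(a < c \<and> c < b) \<or> (a < d \<and> d < b)"
    using sj
  proof
    assume "s = a \<and> s + j = b"
    then have "a < s + i" "s + i < b" using ijk by linarith+
    with i show ?thesis using assms(2) by (elim disjE) simp_all
  next
    assume "s = b \<and> s + j = a + N"
    then have "a + N < s + k" "s + k < b + N" using ijk by linarith+
    with k show ?thesis using assms(3,4) by (elim disjE) simp_all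
  qed
  moreover have "\<not> (a < c \<and> c < b \<and> a < d \<and> d < b)"
  proof
    assume *: "a < c \<and> c < b \<and> a < d \<and> d < b"
    from sj show False
    proof
      assume "s = a \<and> s + j = b"
      with k show False by (elim disjE) (use ijk assms(1-4) * in \<open>linarith+\<close>)
    next
      assume "s = b \<and> s + j = a + N"
      with i show False by (elim disjE) (use ijk assms(1-4) * in \<open>linarith+\<close>)
    qed
  qed
  ultimately show ?R by blast
next
  assume R: ?R
  have "\<not> (a = c \<and> b = d)" using R by auto
  then have "{a, b} \<inter> {c, d} = {}" using disj assms(1-4) by (auto simp: doubleton_eq_iff)
  then have "a \<noteq> c \<and> a \<noteq> d \<and> b \<noteq> c \<and> b \<noteq> d" by auto
  with R assms consider "a < c" "c < b" "b < d" | "c < a" "a < d" "d < b" by linarith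
  then show ?L
  proof cases
    case 1
    then have "0 < c - a" "c - a < b - a" "b - a < d - a" "d - a < N" using assms(1-4) by linarith+
    note * = this
    show ?thesis
      by (rule exI[of _ a], rule exI[of _ "c - a"], rule exI[of _ "b - a"], rule exI[of _ "d - a"])
        (use * 1 assms(1-4) in simp)
  next
    case 2
    then have wrap: "(a + (c + N - a)) mod N = c" using assms(1-4) by simp
    have *: "0 < d - a" "d - a < b - a" "b - a < c + N - a" "c + N - a < N"
      using 2 assms(1-4) by linarith+
    show ?thesis
      by (rule exI[of _ a], rule exI[of _ "d - a"], rule exI[of _ "b - a"], rule exI[of _ "c + N - a"])
        (use * 2 wrap assms(1-4) in simp)
  qed
qed

text \<open>A side of a twisted edge joins two flags that point in the same direction around the
  vertex-disc, that is, two flags of one orbit of \<open>next_half_edge\<close>; a side of an untwisted edge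
  joins flags that point in opposite directions.\<close>

definition twisted :: "'a ribbon_graph \<Rightarrow> 'a set \<Rightarrow> bool" where
  "twisted G e \<longleftrightarrow> (\<exists>x\<in>e. \<exists>m. side G x = (next_half_edge G ^^ m) x)"

text \<open>The kernel, over the field with two elements, of the adjacency matrix of the intersection
  graph with diagonal entry 1 at the twisted edges; a vector is encoded as its support.\<close>

definition face_kernel :: "'a ribbon_graph \<Rightarrow> 'a set set set" where
  "face_kernel G = {h \<in> Pow (edges G). \<forall>e\<in>edges G.
     odd (card {f \<in> h. interlaced G e f}) \<longleftrightarrow> twisted G e \<and> e \<in> h}"

context based_bouquet
begin

lemma period_p: "0 < m \<Longrightarrow> m < N \<Longrightarrow> p (k + m) \<noteq> p k"
proof
  assume "0 < m" "m < N" "p (k + m) = p k"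
  then have "p (m + k) = p (0 + k)" by (simp add: add.commute)
  from p_cancel[OF this] have "p m = p 0" .
  then show False using p_eq_iff[of m 0] \<open>0 < m\<close> \<open>m < N\<close> by simp
qed

definition edge_at :: "nat \<Rightarrow> 'a set" where "edge_at k = edge_of G (p k)"

lemma edge_at_eq_iff: "e \<in> edges G \<Longrightarrow> edge_at k = e \<longleftrightarrow> p k \<in> e"
  using edge_eq_edge_of[OF ribbon, of e "p k"] by (auto simp: edge_at_def edge_of_def)

lemma q_mem_iff: "e \<in> edges G \<Longrightarrow> q k \<in> e \<longleftrightarrow> p k \<in> e"
proof -
  assume e: "e \<in> edges G"
  have "seg G x \<in> e" if "x \<in> e" for x
    using edge_eq_edge_of[OF ribbon e that] by (auto simp: edge_of_def)
  then show ?thesis using seg_p seg_q by metis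
qed

lemma edge_of_q: "edge_of G (q k) = edge_at k"
  using edge_of_eq[OF ribbon, of "p k" "q k"] by (simp add: edge_at_def edge_of_def seg_p)

lemma p_mem_mod: "p (k mod N) \<in> e \<longleftrightarrow> p k \<in> e" by (simp add: p_mod)

text \<open>Exchanging the two positions is harmless: a side that leaves \<open>p a\<close> towards the segment at \<open>b\<close>
  yields one that leaves \<open>p b\<close> towards the segment at \<open>a\<close>.\<close>

lemma edge_positions:
  assumes e: "e \<in> edges G"
  obtains a b where "a < b" "b < N" "e = {p a, q a, p b, q b}" "side G (p a) = p b \<or> side G (p a) = q b"
    "\<forall>t<N. p t \<in> e \<longleftrightarrow> t = a \<or> t = b"
proof -
  have flag: "\<exists>k<N. x = p k \<or> x = q k" if "x \<in> flags G" for x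
    using that flags_eq by auto
  obtain x where x: "x \<in> flags G" "e = edge_of G x" using e by (auto simp: edges_eq[OF ribbon])
  obtain a where a: "a < N" "x = p a \<or> x = q a" using flag[OF x(1)] by blast
  have ea: "e = {p a, q a, side G (p a), seg G (side G (p a))}"
  proof -
    have "e = edge_at a" using a(2) x(2) edge_of_q[of a] by (elim disjE) (simp_all only: edge_at_def)
    then show ?thesis by (simp only: edge_at_def edge_of_def seg_p)
  qed
  obtain b where b: "b < N" "side G (p a) = p b \<or> side G (p a) = q b"
    using flag[of "side G (p a)"] fc(2)[of "p a"] by auto
  have eb: "e = {p a, q a, p b, q b}"
    using b(2) unfolding ea by (elim disjE) (simp_all add: seg_p seg_q insert_commute)
  have "a \<noteq> b" using b fc(8)[of "p a"] fc(10)[of "p a"] by (auto simp: seg_p)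
  have pos: "\<forall>t<N. p t \<in> e \<longleftrightarrow> t = a \<or> t = b"
    using a b p_neq_q by (auto simp: eb p_eq_iff)
  show thesis
  proof (cases "a < b")
    case True
    then show ?thesis by (rule that[OF _ b(1) eb b(2) pos])
  next
    case False
    then have "b < a" using \<open>a \<noteq> b\<close> by simp
    have "side G (p b) = p a \<or> side G (p b) = q a"
    proof (cases "side G (p a) = p b")
      case True
      then show ?thesis using fc(5)[of "p a"] by simp
    next
      case False
      then have "side G (p a) = q b" using b by blast
      then have "side G (p b) = seg G (side G (side G (p a)))"
        using fc(11)[of "q b"] by (simp add: seg_q)
      then show ?thesis using fc(5)[of "p a"] by (simp add: seg_p)
    qed
    moreover have "e = {p b, q b, p a, q a}" using eb by blast
    moreover have "\<forall>t<N. p t \<in> e \<longleftrightarrow> t = b \<or> t = a" using pos by blast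
    ultimately show ?thesis using that[OF \<open>b < a\<close> a(1)] by simp
  qed
qed

text \<open>The witness of \<open>interlaced\<close> may be a flag that points against the chosen direction.  The
  four half-edges are then met in reverse, and the walk is restarted at the third of them.\<close>

lemma interlaced_iff_positions:
  assumes e: "e \<in> edges G" and f: "f \<in> edges G"
  shows "interlaced G e f \<longleftrightarrow> (\<exists>s i j k. 0 < i \<and> i < j \<and> j < k \<and> k < N \<and> s < N \<and>
    p s \<in> e \<and> p (s + i) \<in> f \<and> p (s + j) \<in> e \<and> p (s + k) \<in> f)" (is "_ \<longleftrightarrow> ?R")
proof
  assume ?R
  then obtain s i j k where *: "0 < i" "i < j" "j < k" "k < N"
    "p s \<in> e" "p (s + i) \<in> f" "p (s + j) \<in> e" "p (s + k) \<in> f" by blast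
  show "interlaced G e f"
    unfolding interlaced_def
    by (rule exI[of _ "p s"], rule exI[of _ i], rule exI[of _ j], rule exI[of _ k])
       (use * in \<open>simp add: next_pow_p period_p\<close>)
next
  assume "interlaced G e f"
  then obtain x i j k where ijk: "0 < i" "i < j" "j < k"
    and ret: "\<And>m. 0 < m \<Longrightarrow> m \<le> k \<Longrightarrow> (next_half_edge G ^^ m) x \<noteq> x"
    and mem: "x \<in> e" "(next_half_edge G ^^ i) x \<in> f" "(next_half_edge G ^^ j) x \<in> e" "(next_half_edge G ^^ k) x \<in> f"
    unfolding interlaced_def by blast
  have positions: "?R" if *: "0 < i" "i < j" "j < k" "k < N"
    "p s \<in> e" "p (s + i) \<in> f" "p (s + j) \<in> e" "p (s + k) \<in> f" for s i j k
  proof -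
    have "p (s mod N + m) = p (s + m)" for m
      by (metis p_mod mod_add_left_eq)
    moreover have "p (s mod N) = p s" by (rule p_mod)
    moreover have "s mod N < N" using N_pos by simp
    ultimately show ?thesis using * by metis
  qed
  have "x \<in> flags G" using edge_eq_edge_of[OF ribbon e mem(1)] by simp
  then consider s where "x = p s" | s where "s < N" "x = q s" using flags_eq by auto
  then show ?R
  proof cases
    case 1
    have "k < N"
    proof (rule ccontr)
      assume "\<not> k < N"
      then show False using ret[of N] N_pos by (simp add: 1 next_pow_p p_add_N)
    qed
    then show ?thesis using ijk mem positions[of i j k s] by (simp add: 1 next_pow_p)
  next
    case 2
    have q_N: "q (s + N) = q s" by (simp add: q_def p_add_N)
    have pow_x: "(next_half_edge G ^^ m) x = q (s + N - m)" if "m \<le> N" for m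
      using next_pow_q[of m "s + N - m"] that by (simp add: 2 q_N)
    have k: "k < N"
    proof (rule ccontr)
      assume "\<not> k < N"
      then show False using ret[of N] N_pos pow_x[of N] by (simp add: 2)
    qed
    define u where "u = s + N - j"
    have "p u \<in> e" "p (s + N - i) \<in> f" "p (s + N) \<in> e" "p (s + N - k) \<in> f"
      using mem ijk k pow_x[of i] pow_x[of j] pow_x[of k] 2 q_mem_iff[OF e] q_mem_iff[OF f]
      by (simp_all add: u_def p_add_N)
    moreover have "p (s + N - k + N) = p (s + N - k)" by (rule p_add_N)
    moreover have "s + N - i = u + (j - i)" "s + N = u + j" "s + N - k + N = u + (j + N - k)"
      using ijk k by (auto simp: u_def)
    ultimately have "p (u + (j - i)) \<in> f" "p (u + j) \<in> e" "p (u + (j + N - k)) \<in> f" by metis+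
    moreover have "0 < j - i" "j - i < j" "j < j + N - k" "j + N - k < N" using ijk k by simp_all
    ultimately show ?thesis using \<open>p u \<in> e\<close> by (intro positions[of "j - i" j "j + N - k" u])
  qed
qed

text \<open>Two edges have the same two positions or none in common.  In the first case neither side
  holds, so no edge is interlaced with itself.\<close>

lemma interlaced_iff_odd:
  assumes e: "e \<in> edges G" and f: "f \<in> edges G"
    and ab: "a < b" "b < N" and e_iff: "\<forall>t<N. p t \<in> e \<longleftrightarrow> t = a \<or> t = b"
  shows "interlaced G e f \<longleftrightarrow> odd (card {t \<in> {a<..<b}. edge_at t = f})"
proof -
  obtain c d where cd: "c < d" "d < N" and f_iff: "\<forall>t<N. p t \<in> f \<longleftrightarrow> t = c \<or> t = d"
    by (rule edge_positions[OF f]) (rule that)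
  have "e = f \<or> e \<inter> f = {}"
    using edge_eq_edge_of[OF ribbon e] edge_eq_edge_of[OF ribbon f] by blast
  then have disj: "{a, b} = {c, d} \<or> {a, b} \<inter> {c, d} = {}"
  proof
    assume "e = f"
    then have "t = a \<or> t = b \<longleftrightarrow> t = c \<or> t = d" if "t < N" for t using e_iff f_iff that by blast
    from this[of a] this[of b] this[of c] this[of d] have "a = c" "b = d" using ab cd by auto
    then show ?thesis by simp
  next
    assume "e \<inter> f = {}"
    then have "\<not> (p t \<in> e \<and> p t \<in> f)" for t by blast
    moreover have "a < N" using ab by simp
    ultimately have "t \<notin> {c, d}" if "t \<in> {a, b}" for t
      using that ab(2) e_iff[rule_format, of t] f_iff[rule_format, of t] by (elim insertE emptyE) simp_all
    then show ?thesis by blast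
  qed
  have e': "p t \<in> e \<longleftrightarrow> t mod N \<in> {a, b}" for t
    using e_iff[rule_format, of "t mod N"] N_pos p_mem_mod[of t e] by simp
  have f': "p t \<in> f \<longleftrightarrow> t mod N \<in> {c, d}" for t
    using f_iff[rule_format, of "t mod N"] N_pos p_mem_mod[of t f] by simp
  have "interlaced G e f \<longleftrightarrow> (a < c \<and> c < b) \<noteq> (a < d \<and> d < b)"
    unfolding interlaced_iff_positions[OF e f] e' f'
    by (subst alternating_iff[OF ab(1,2) cd(1,2) disj, symmetric])
      (intro ex_cong1 conj_cong refl, simp)
  moreover have "{t \<in> {a<..<b}. edge_at t = f} = {t \<in> {c, d}. a < t \<and> t < b}"
    using cd ab(2) f_iff by (auto simp: edge_at_eq_iff[OF f])
  moreover have "{t \<in> {c, d}. a < t \<and> t < b} =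
      (if a < c \<and> c < b then {c} else {}) \<union> (if a < d \<and> d < b then {d} else {})" by auto
  moreover have "odd (card ((if P then {c} else {}) \<union> (if Q then {d} else {}))) \<longleftrightarrow> P \<noteq> Q" for P Q
    using cd(1) by auto
  ultimately show ?thesis by simp
qed

end

context based_bouquet
begin

section \<open>Colourings of the boundary\<close>

text \<open>The powers of \<open>next_half_edge\<close> preserve the direction of a flag, so a twisted edge has a side
  that joins two flags of the form \<open>p k\<close> or two of the form \<open>q k\<close>.\<close>

lemma twisted_iff:
  assumes e: "e = {p a, q a, p b, q b}" and ab: "a \<noteq> b" "a < N" "b < N"
    and side: "side G (p a) = p b \<or> side G (p a) = q b"
  shows "twisted G e \<longleftrightarrow> side G (p a) = p b"
proof
  assume eq: "side G (p a) = p b"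
  have "p (b + N - a + a) = p b" using ab by (simp add: p_add_N)
  then have "side G (p a) = (next_half_edge G ^^ (b + N - a)) (p a)"
    using eq by (simp add: next_pow_p add.commute)
  then show "twisted G e" unfolding twisted_def e by blast
next
  assume "twisted G e"
  then obtain x m where x: "x \<in> {p a, q a, p b, q b}" "side G x = (next_half_edge G ^^ m) x"
    unfolding twisted_def e by blast
  have pq: "side G x \<in> range p \<longleftrightarrow> x \<in> range p"
  proof -
    consider k where "x = p k" | k where "x = q k" using x(1) by blast
    then show ?thesis
    proof cases
      case 1
      then show ?thesis using x(2) by (simp add: next_pow_p)
    next
      case 2
      have "p (k + m * N) = p k" by (metis p_mod mod_mult_self1)
      then have "q (k + m * N) = q k" by (simp add: q_def)
      moreover have "k + m * N - m + m = k + m * N" using N_pos by (simp add: trans_le_add2)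
      ultimately have "side G x = q (k + m * N - m)"
        using next_pow_q[of m "k + m * N - m"] x(2) 2 by metis
      then show ?thesis using p_neq_q 2 by (metis rangeE)
    qed
  qed
  show "side G (p a) = p b"
  proof (rule ccontr)
    assume "side G (p a) \<noteq> p b"
    then have a: "side G (p a) = q b" using side by simp
    then have b: "side G (q b) = p a" using fc(5)[of "p a"] by simp
    have qa: "side G (q a) = p b"
      using fc(11)[of "p a"] a by (simp add: seg_p seg_q)
    then have pb: "side G (p b) = q a" using fc(5)[of "q a"] by simp
    have "q k \<notin> range p" for k using p_neq_q by (metis rangeE)
    then show False using x(1) pq a b qa pb by (elim insertE emptyE) (metis rangeI)+
  qed
qed

definition crossings :: "'a set set \<Rightarrow> nat \<Rightarrow> nat" where
  "crossings h k = card {t \<in> {..<k}. edge_at t \<in> h}"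

lemma crossings_0 [simp]: "crossings h 0 = 0" by (simp add: crossings_def)

lemma crossings_Suc: "crossings h (Suc k) = crossings h k + (if edge_at k \<in> h then 1 else 0)"
proof -
  have "{t \<in> {..<Suc k}. edge_at t \<in> h} =
      (if edge_at k \<in> h then insert k {t \<in> {..<k}. edge_at t \<in> h} else {t \<in> {..<k}. edge_at t \<in> h})"
    by (auto simp: less_Suc_eq)
  then show ?thesis by (simp add: crossings_def)
qed

lemma crossings_between:
  "a < b \<Longrightarrow> crossings h b = crossings h (Suc a) + card {t \<in> {a<..<b}. edge_at t \<in> h}"
proof -
  assume "a < b"
  then have eq: "{t \<in> {..<b}. edge_at t \<in> h} = {t \<in> {..<Suc a}. edge_at t \<in> h} \<union> {t \<in> {a<..<b}. edge_at t \<in> h}"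
    by auto
  show ?thesis unfolding crossings_def eq by (rule card_Un_disjoint) auto
qed

lemma even_crossings_N:
  assumes h: "h \<subseteq> edges G"
  shows "even (crossings h N)"
proof -
  have "card {t \<in> {..<N}. edge_at t = f} = 2" if "f \<in> h" for f
  proof -
    have f: "f \<in> edges G" using that h by blast
    obtain a b where "a < b" "b < N" "\<forall>t<N. p t \<in> f \<longleftrightarrow> t = a \<or> t = b"
      by (rule edge_positions[OF f]) (rule that)
    then have "{t \<in> {..<N}. edge_at t = f} = {a, b}" by (auto simp: edge_at_eq_iff[OF f])
    then show ?thesis using \<open>a < b\<close> by simp
  qed
  then have "{f \<in> h. odd (card {t \<in> {..<N}. edge_at t = f})} = {}" by auto
  then have "even (card {f \<in> h. odd (card {t \<in> {..<N}. edge_at t = f})})" by (simp only: card.empty) simp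
  then show ?thesis
    unfolding crossings_def
    using even_card_vimage[of h "{..<N}" edge_at] h finite_edges[OF ribbon] finite_subset by blast
qed

text \<open>Colourings of the flags, each given by its first colour class, that are constant along the
  arcs of the vertex-disc and change at a segment iff its edge is in \<open>h\<close>.  Constancy along the
  sides of the edges is the separate condition that cuts out the kernel.\<close>

definition colourings :: "'a set set \<Rightarrow> 'a set set" where
  "colourings h = {U. U \<subseteq> flags G \<and> (\<forall>x\<in>flags G. (arc G x \<in> U \<longleftrightarrow> x \<in> U) \<and>
     ((seg G x \<in> U) \<noteq> (x \<in> U) \<longleftrightarrow> edge_of G x \<in> h))}"

lemma colour_q: "U \<in> colourings h \<Longrightarrow> q k \<in> U \<longleftrightarrow> p (Suc k) \<in> U"
proof -
  assume "U \<in> colourings h"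
  then have "arc G (q k) \<in> U \<longleftrightarrow> q k \<in> U" by (simp add: colourings_def)
  then show ?thesis by (simp add: arc_q)
qed

lemma colour_p: "U \<in> colourings h \<Longrightarrow> p k \<in> U \<longleftrightarrow> (x0 \<in> U) \<noteq> odd (crossings h k)"
proof (induction k)
  case (Suc k)
  have "(q k \<in> U) \<noteq> (p k \<in> U) \<longleftrightarrow> edge_at k \<in> h"
  proof -
    have "(seg G (p k) \<in> U) \<noteq> (p k \<in> U) \<longleftrightarrow> edge_of G (p k) \<in> h"
      using Suc.prems by (simp add: colourings_def)
    then show ?thesis by (simp only: seg_p edge_at_def)
  qed
  then show ?case using Suc colour_q[OF Suc.prems, of k] by (auto simp: crossings_Suc)
qed simp

text \<open>The colour of the base flag determines the colouring, by counting crossings along the walk,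
  and it can be chosen freely, because a full turn crosses each edge twice.\<close>

lemma card_colourings:
  assumes h: "h \<subseteq> edges G"
  shows "card (colourings h) = 2"
proof -
  have "bij_betw (\<lambda>U. x0 \<in> U) (colourings h) UNIV"
    unfolding bij_betw_def
  proof
    show "inj_on (\<lambda>U. x0 \<in> U) (colourings h)"
    proof (rule inj_onI)
      fix U V assume UV: "U \<in> colourings h" "V \<in> colourings h" "(x0 \<in> U) = (x0 \<in> V)"
      have "p k \<in> U \<longleftrightarrow> p k \<in> V" for k using colour_p UV by metis
      moreover from this have "q k \<in> U \<longleftrightarrow> q k \<in> V" for k using colour_q UV by metis
      ultimately have "x \<in> U \<longleftrightarrow> x \<in> V" if "x \<in> flags G" for x
        using that flags_eq by auto
      moreover have "U \<subseteq> flags G" "V \<subseteq> flags G" using UV by (auto simp: colourings_def)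
      ultimately show "U = V" by blast
    qed
    have "\<exists>U\<in>colourings h. (x0 \<in> U) = c" for c
    proof -
      define s where "s k \<longleftrightarrow> c \<noteq> odd (crossings h k)" for k
      define U where "U = p ` {k. k < N \<and> s k} \<union> q ` {k. k < N \<and> s (Suc k)}"
      have pU: "p k \<in> U \<longleftrightarrow> s k" if "k < N" for k
        using that p_neq_q unfolding U_def by (auto simp: p_eq_iff image_iff)
      have qU: "q k \<in> U \<longleftrightarrow> s (Suc k)" if "k < N" for k
        using that p_neq_q unfolding U_def by (auto simp: q_eq_iff image_iff dest: sym)
      have pU': "p k \<in> U \<longleftrightarrow> s k" if "k \<le> N" for k
      proof (cases "k = N")
        case True
        then show ?thesis using pU[of 0] N_pos even_crossings_N[OF h] by (simp add: p_N s_def)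
      next
        case False
        then show ?thesis using pU that by simp
      qed
      have arcs: "arc G (q k) \<in> U \<longleftrightarrow> q k \<in> U" if "k < N" for k
        using that pU'[of "Suc k"] qU[of k] by (simp add: arc_q)
      have arcs': "arc G (p k) \<in> U \<longleftrightarrow> p k \<in> U" if "k < N" for k
      proof (cases k)
        case (Suc j)
        then show ?thesis using arcs[of j] that by (simp add: arc_p arc_q)
      next
        case 0
        obtain j where j: "N = Suc j" using N_pos gr0_conv_Suc by blast
        have "p k = arc G (q j)" using 0 p_N arc_q[of j] by (simp add: j)
        moreover have "arc G (arc G (q j)) = q j" by (rule fc(6)[OF q_in])
        ultimately show ?thesis using arcs[of j] by (simp add: j)
      qed
      have jump: "(q k \<in> U) \<noteq> (p k \<in> U) \<longleftrightarrow> edge_at k \<in> h" if "k < N" for k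
        using pU[OF that] qU[OF that] by (auto simp: s_def crossings_Suc)
      have "(arc G x \<in> U \<longleftrightarrow> x \<in> U) \<and> ((seg G x \<in> U) \<noteq> (x \<in> U) \<longleftrightarrow> edge_of G x \<in> h)"
        if x: "x \<in> flags G" for x
      proof -
        consider k where "k < N" "x = p k" | k where "k < N" "x = q k" using x flags_eq by auto
        then show ?thesis
        proof cases
          case 1
          then show ?thesis using arcs'[of k] jump[of k] by (simp add: seg_p edge_at_def)
        next
          case 2
          then show ?thesis using arcs[of k] jump[of k] by (auto simp: seg_q edge_of_q)
        qed
      qed
      moreover have "U \<subseteq> flags G" unfolding U_def by auto
      ultimately have "U \<in> colourings h" by (simp add: colourings_def)
      moreover have "(x0 \<in> U) = c" using pU[of 0] N_pos by (simp add: s_def)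
      ultimately show ?thesis by blast
    qed
    then show "(\<lambda>U. x0 \<in> U) ` colourings h = UNIV" by (auto simp: image_iff)
  qed
  from bij_betw_same_card[OF this] show ?thesis by simp
qed

text \<open>Both sides of an edge impose the same condition, since the colour changes at both of its
  segments or at neither.  For the side at \<open>p a\<close> the condition is that the walk from there to the
  other end of the side crosses \<open>h\<close> an even number of times.  That walk crosses the segment at \<open>a\<close>, the
  segments strictly between \<open>a\<close> and \<open>b\<close>, and, if the edge is untwisted, also the segment at \<open>b\<close>.\<close>

lemma colouring_side_invariant_iff:
  assumes h: "h \<subseteq> edges G" and U: "U \<in> colourings h"
  shows "(\<forall>x\<in>flags G. side G x \<in> U \<longleftrightarrow> x \<in> U) \<longleftrightarrow> h \<in> face_kernel G"
proof -
  have jump: "(seg G x \<in> U) \<noteq> (x \<in> U) \<longleftrightarrow> edge_of G x \<in> h" if "x \<in> flags G" for x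
    using U that by (simp add: colourings_def)
  have edge: "(\<forall>x\<in>e. side G x \<in> U \<longleftrightarrow> x \<in> U) \<longleftrightarrow>
      (odd (card {f \<in> h. interlaced G e f}) \<longleftrightarrow> twisted G e \<and> e \<in> h)" if e: "e \<in> edges G" for e
  proof -
    obtain a b where ab: "a < b" "b < N" "e = {p a, q a, p b, q b}"
      and side: "side G (p a) = p b \<or> side G (p a) = q b"
      and pos: "\<forall>t<N. p t \<in> e \<longleftrightarrow> t = a \<or> t = b"
      by (rule edge_positions[OF e]) (rule that)
    let ?c = "card {t \<in> {a<..<b}. edge_at t \<in> h}"
    have "{f \<in> h. interlaced G e f} = {f \<in> h. odd (card {t \<in> {a<..<b}. edge_at t = f})}"
      using h interlaced_iff_odd[OF e _ ab(1,2) pos] by blast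
    then have parity: "odd (card {f \<in> h. interlaced G e f}) \<longleftrightarrow> odd ?c"
      using even_card_vimage[of h "{a<..<b}" edge_at] h finite_edges[OF ribbon] finite_subset by auto
    have tw: "twisted G e \<longleftrightarrow> side G (p a) = p b"
      using ab side by (intro twisted_iff) auto
    have Ea: "edge_at a = e" "edge_at b = e" using ab(1,2) pos[rule_format] by (simp_all add: edge_at_eq_iff[OF e])
    have eq: "edge_of G x = e" if "x \<in> e" for x using edge_eq_edge_of[OF ribbon e that] by simp
    have fl: "x \<in> flags G" if "x \<in> e" for x using edge_eq_edge_of[OF ribbon e that] by simp
    have sd: "side G x \<in> e" "seg G x \<in> e" if "x \<in> e" for x
      using eq[OF that] by (auto simp: edge_of_def)
    have one: "(\<forall>x\<in>e. side G x \<in> U \<longleftrightarrow> x \<in> U) \<longleftrightarrow> (side G (p a) \<in> U \<longleftrightarrow> p a \<in> U)"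
    proof
      assume *: "side G (p a) \<in> U \<longleftrightarrow> p a \<in> U"
      have pa: "p a \<in> e" using ab by simp
      have e_eq: "e = {p a, seg G (p a), side G (p a), seg G (side G (p a))}"
        using eq[OF pa] by (simp add: edge_of_def)
      have j: "(seg G x \<in> U) \<noteq> (x \<in> U) \<longleftrightarrow> e \<in> h" if "x \<in> e" for x
        using jump[OF fl[OF that]] eq[OF that] by simp
      show "\<forall>x\<in>e. side G x \<in> U \<longleftrightarrow> x \<in> U"
        using * j[OF pa] j[OF sd(1)[OF pa]] fc(4,5,11)[OF fl[OF pa]]
          fc(11)[OF fc(2)[OF fl[OF pa]]]
        unfolding e_eq by auto
    qed (use ab in blast)
    have pa: "p a \<in> U \<longleftrightarrow> (x0 \<in> U) \<noteq> odd (crossings h a)" and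
      pb: "p b \<in> U \<longleftrightarrow> (x0 \<in> U) \<noteq> odd (crossings h b)" and
      qb: "q b \<in> U \<longleftrightarrow> (x0 \<in> U) \<noteq> odd (crossings h (Suc b))"
      using colour_p[OF U] colour_q[OF U] by blast+
    have cb: "odd (crossings h b) \<longleftrightarrow> odd (crossings h a + (if e \<in> h then 1 else 0) + ?c)"
      using crossings_between[OF ab(1), of h] by (simp add: crossings_Suc Ea)
    show ?thesis
    proof (cases "side G (p a) = p b")
      case True
      then show ?thesis unfolding one parity using pa pb cb tw by auto
    next
      case False
      then have "side G (p a) = q b" using side by simp
      then show ?thesis unfolding one parity using pa qb cb tw False by (auto simp: crossings_Suc Ea)
    qed
  qed
  have "(\<forall>x\<in>flags G. side G x \<in> U \<longleftrightarrow> x \<in> U) \<longleftrightarrow> (\<forall>e\<in>edges G. \<forall>x\<in>e. side G x \<in> U \<longleftrightarrow> x \<in> U)"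
  proof -
    have "x \<in> flags G" if "e \<in> edges G" "x \<in> e" for e x
      using edge_eq_edge_of[OF ribbon that] by simp
    moreover have "\<exists>e\<in>edges G. x \<in> e" if "x \<in> flags G" for x
      using that by (auto simp: edges_eq[OF ribbon] edge_of_def)
    ultimately show ?thesis by metis
  qed
  also have "\<dots> \<longleftrightarrow> h \<in> face_kernel G"
    unfolding face_kernel_def using h edge by simp
  finally show ?thesis .
qed

text \<open>A union of faces is a colouring that is constant along arcs and sides.  The set \<open>h\<close> of edges
  at which it changes is unique, so these colourings split into pairs indexed by the kernel.\<close>

theorem two_power_num_faces: "2 ^ num_faces G = 2 * card (face_kernel G)"
proof -
  let ?I = "invariant_sets (flags G) {side G, arc G}"
  have I_iff: "U \<in> ?I \<longleftrightarrow> U \<subseteq> flags G \<and> (\<forall>x\<in>flags G. side G x \<in> U \<longleftrightarrow> x \<in> U) \<and>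
      (\<forall>x\<in>flags G. arc G x \<in> U \<longleftrightarrow> x \<in> U)" for U
    by (auto simp: invariant_sets_def)
  have "?I = (\<Union>h\<in>face_kernel G. colourings h)"
  proof (intro equalityI subsetI)
    fix U assume "U \<in> ?I"
    then have U: "U \<subseteq> flags G" "\<And>x. x \<in> flags G \<Longrightarrow> side G x \<in> U \<longleftrightarrow> x \<in> U"
      "\<And>x. x \<in> flags G \<Longrightarrow> arc G x \<in> U \<longleftrightarrow> x \<in> U" unfolding I_iff by auto
    define h where "h = {e \<in> edges G. \<exists>x\<in>e. x \<in> U \<and> seg G x \<notin> U}"
    have "(seg G x \<in> U) \<noteq> (x \<in> U) \<longleftrightarrow> edge_of G x \<in> h" if x: "x \<in> flags G" for x
    proof -
      have "edge_of G x \<in> edges G" using x by (auto simp: edges_eq[OF ribbon])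
      then show ?thesis
        using U(2)[OF x] U(2)[OF fc(1)[OF x]] fc(4,11)[OF x] fc(4)[OF fc(2)[OF x]]
        by (auto simp: h_def edge_of_def)
    qed
    then have "U \<in> colourings h" using U by (simp add: colourings_def)
    moreover have "h \<subseteq> edges G" by (auto simp: h_def)
    ultimately show "U \<in> (\<Union>h\<in>face_kernel G. colourings h)"
      using colouring_side_invariant_iff[of h U] U(2) by blast
  next
    fix U assume "U \<in> (\<Union>h\<in>face_kernel G. colourings h)"
    then obtain h where h: "h \<in> face_kernel G" and U: "U \<in> colourings h" by blast
    then have "\<forall>x\<in>flags G. side G x \<in> U \<longleftrightarrow> x \<in> U"
      using colouring_side_invariant_iff[of h U] by (simp add: face_kernel_def)
    then show "U \<in> ?I" using U unfolding I_iff by (simp add: colourings_def)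
  qed
  moreover have "card (\<Union>h\<in>face_kernel G. colourings h) = (\<Sum>h\<in>face_kernel G. card (colourings h))"
  proof (rule card_UN_disjoint)
    show "finite (face_kernel G)"
      using finite_edges[OF ribbon] by (simp add: face_kernel_def)
    show "\<forall>h\<in>face_kernel G. finite (colourings h)"
      by (intro ballI card_ge_0_finite) (simp add: card_colourings face_kernel_def)
    have "h = h'" if "h \<subseteq> edges G" "h' \<subseteq> edges G" "U \<in> colourings h" "U \<in> colourings h'" for h h' U
    proof -
      have "edge_of G x \<in> h \<longleftrightarrow> edge_of G x \<in> h'" if "x \<in> flags G" for x
        using \<open>U \<in> colourings h\<close> \<open>U \<in> colourings h'\<close> that by (auto simp: colourings_def)
      then show ?thesis using that(1,2) by (auto simp: edges_eq[OF ribbon])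
    qed
    then show "\<forall>h\<in>face_kernel G. \<forall>h'\<in>face_kernel G. h \<noteq> h' \<longrightarrow> colourings h \<inter> colourings h' = {}"
      by (auto simp: face_kernel_def)
  qed
  moreover have "(\<Sum>h\<in>face_kernel G. card (colourings h)) = (\<Sum>h\<in>face_kernel G. 2)"
    using card_colourings by (intro sum.cong) (auto simp: face_kernel_def)
  moreover have "card ?I = 2 ^ num_faces G"
    using card_invariant_sets[of "flags G" "{side G, arc G}"] finite_flags involutions
    by (simp add: num_faces_def isolated_eq)
  ultimately show ?thesis by simp
qed

end

section \<open>Partial Petrials of a bouquet\<close>

context
  fixes G :: "'a ribbon_graph" and A :: "'a set set"
  assumes G: "is_ribbon_graph G" and A: "A \<subseteq> edges G"
begin

lemma partial_petrial_simps [simp]: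
  "flags (partial_petrial G A) = flags G" "seg (partial_petrial G A) = seg G"
  "arc (partial_petrial G A) = arc G" "isolated (partial_petrial G A) = isolated G"
  by (simp_all add: partial_petrial_def)

lemma side_partial_petrial:
  assumes x: "x \<in> flags G"
  shows "side (partial_petrial G A) x = (if edge_of G x \<in> A then seg G (side G x) else side G x)"
proof -
  have "x \<in> \<Union>A \<longleftrightarrow> edge_of G x \<in> A"
  proof
    assume "x \<in> \<Union>A"
    then obtain e where "e \<in> A" "x \<in> e" by blast
    then show "edge_of G x \<in> A" using edge_eq_edge_of[OF G, of e x] A by auto
  qed (auto simp: edge_of_def)
  then show ?thesis by (simp add: partial_petrial_def)
qed

lemma edge_of_partial_petrial: "x \<in> flags G \<Longrightarrow> edge_of (partial_petrial G A) x = edge_of G x"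
  by (auto simp: edge_of_def[of "partial_petrial G A"] side_partial_petrial flags_closed[OF G])
     (auto simp: edge_of_def)

lemma is_ribbon_graph_partial_petrial: "is_ribbon_graph (partial_petrial G A)"
proof -
  note fc = flags_closed[OF G]
  have same: "edge_of G (seg G x) = edge_of G x" "edge_of G (side G x) = edge_of G x"
    "edge_of G (seg G (side G x)) = edge_of G x" if "x \<in> flags G" for x
    by (rule edge_of_eq[OF G that], simp add: edge_of_def)+
  have inj: "seg G x = seg G y \<Longrightarrow> x = y" if "x \<in> flags G" "y \<in> flags G" for x y
    using fc(4) that by metis
  have "side (partial_petrial G A) x \<in> flags G \<and> side (partial_petrial G A) x \<noteq> x \<and>
      side (partial_petrial G A) (side (partial_petrial G A) x) = x \<and>
      side (partial_petrial G A) x \<noteq> seg G x \<and>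
      side (partial_petrial G A) (seg G x) = seg G (side (partial_petrial G A) x)"
    if x: "x \<in> flags G" for x
  proof -
    have "seg G (side G x) \<noteq> x" using fc(4)[OF fc(2)[OF x]] fc(10)[OF x] by metis
    moreover have "seg G (side G x) \<noteq> seg G x" using inj[of "side G x" x] fc(2,8)[OF x] x by blast
    ultimately show ?thesis
      using x by (simp add: side_partial_petrial same fc)
  qed
  then show ?thesis
    using G by (simp add: is_ribbon_graph_def fpf_involution_on_def)
qed

lemma edges_partial_petrial: "edges (partial_petrial G A) = edges G"
  by (auto simp: edges_eq[OF G] edges_eq[OF is_ribbon_graph_partial_petrial] edge_of_partial_petrial)

lemma next_half_edge_partial_petrial: "next_half_edge (partial_petrial G A) = next_half_edge G"
  by (rule ext) (simp add: next_half_edge_def)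

lemma interlaced_partial_petrial: "interlaced (partial_petrial G A) = interlaced G"
  by (intro ext) (simp add: interlaced_def next_half_edge_partial_petrial)

lemma bouquet_partial_petrial: "bouquet G \<Longrightarrow> bouquet (partial_petrial G A)"
  using is_ribbon_graph_partial_petrial by (simp add: bouquet_def num_vertices_def)

end

context based_bouquet
begin

text \<open>Moving the far end of a side across its segment reverses the direction of that end.  The walk
  around the vertex-disc does not see the sides, so the positions are those of the given bouquet.\<close>

lemma twisted_partial_petrial:
  assumes A: "A \<subseteq> edges G" and e: "e \<in> edges G"
  shows "twisted (partial_petrial G A) e \<longleftrightarrow> twisted G e \<noteq> (e \<in> A)"
proof -
  have P: "based_bouquet (partial_petrial G A) x0"
    using bouquet_partial_petrial[OF ribbon A bouquet] base
    by (simp add: based_bouquet_def partial_petrial_def)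
  have p: "based_bouquet.p (partial_petrial G A) x0 = p"
    by (rule ext) (simp add: based_bouquet.p_def[OF P] p_def next_half_edge_partial_petrial[OF ribbon A])
  have q: "based_bouquet.q (partial_petrial G A) x0 = q"
    by (rule ext) (simp add: based_bouquet.q_def[OF P] q_def p partial_petrial_simps(2)[OF ribbon A])
  have N: "based_bouquet.N (partial_petrial G A) x0 = N"
    by (simp add: based_bouquet.N_def[OF P] N_def p)
  obtain a b where ab: "a < b" "b < N" and eq: "e = {p a, q a, p b, q b}"
    and side: "side G (p a) = p b \<or> side G (p a) = q b"
    by (rule edge_positions[OF e]) (rule that)
  have ab': "a \<noteq> b" "a < N" "b < N" using ab by simp_all
  have "edge_of G (p a) = e" using edge_eq_edge_of[OF ribbon e, of "p a"] eq by simp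
  then have side': "side (partial_petrial G A) (p a) = (if e \<in> A then seg G (side G (p a)) else side G (p a))"
    using side_partial_petrial[OF ribbon A p_in[of a]] by simp
  then have "side (partial_petrial G A) (p a) = p b \<or> side (partial_petrial G A) (p a) = q b"
    using side seg_p seg_q by metis
  then have "twisted (partial_petrial G A) e \<longleftrightarrow> side (partial_petrial G A) (p a) = p b"
    using based_bouquet.twisted_iff[OF P, of e a b] eq ab' unfolding p q N by blast
  moreover have "twisted G e \<longleftrightarrow> side G (p a) = p b"
    using twisted_iff[of e a b] eq ab' side by blast
  moreover have "p b \<noteq> q b" by (rule p_neq_q)
  ultimately show ?thesis using side side' seg_p[of b] seg_q[of b] by (elim disjE) simp_all
qed

text \<open>Restart the walk at the second of the four alternating half-edges; the first one is then
  met again after the fourth.\<close>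

lemma interlaced_sym:
  assumes e: "e \<in> edges G" and f: "f \<in> edges G" and "interlaced G e f"
  shows "interlaced G f e"
proof -
  obtain s i j k where *: "0 < i" "i < j" "j < k" "k < N"
    "p s \<in> e" "p (s + i) \<in> f" "p (s + j) \<in> e" "p (s + k) \<in> f"
    using assms(3) unfolding interlaced_iff_positions[OF e f] by blast
  have pos: "s + i + (j - i) = s + j" "s + i + (k - i) = s + k" "s + i + (N - i) = s + N"
    using * by simp_all
  have ord: "0 < j - i" "j - i < k - i" "k - i < N - i" "N - i < N" using * by simp_all
  have "p (s + i + m) \<noteq> p (s + i)" if "0 < m" "m \<le> N - i" for m
    using that ord(4) by (intro period_p) simp_all
  note * = * this
  show ?thesis
    unfolding interlaced_def
    by (rule exI[of _ "p (s + i)"], rule exI[of _ "j - i"], rule exI[of _ "k - i"], rule exI[of _ "N - i"])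
      (use * ord in \<open>simp add: next_pow_p pos p_add_N del: add_diff_inverse_nat\<close>)
qed

lemma euler_genus_eq: "euler_genus G = int (card (edges G)) + 1 - int (num_faces G)"
  using bouquet by (simp add: euler_genus_def num_components_1 bouquet_def)

end

section \<open>The kernel for a cycle as a transfer problem\<close>

text \<open>The pair \<open>(x (i - 1), x i)\<close> of neighbouring entries of a kernel vector is mapped to
  \<open>(x i, x (i + 1))\<close>, where \<open>d\<close> is the diagonal entry at \<open>i\<close>.\<close>

definition transfer_step :: "bool \<Rightarrow> bool \<times> bool \<Rightarrow> bool \<times> bool" where
  "transfer_step d v = (snd v, fst v \<noteq> (d \<and> snd v))"

primrec transfer :: "nat \<Rightarrow> nat set \<Rightarrow> bool \<times> bool \<Rightarrow> bool \<times> bool" where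
  "transfer 0 D = id"
| "transfer (Suc n) D = transfer_step (n \<in> D) \<circ> transfer n D"

text \<open>Here \<open>i + n - 1\<close> stands for \<open>i - 1\<close>, which would be truncated at \<open>i = 0\<close>.\<close>

definition cyclic_kernel :: "nat \<Rightarrow> nat set \<Rightarrow> nat set set" where
  "cyclic_kernel n D = {X. X \<subseteq> {..<n} \<and> (\<forall>i<n.
     (((i + 1) mod n \<in> X) \<noteq> ((i + n - 1) mod n \<in> X)) \<longleftrightarrow> i \<in> D \<and> i \<in> X)}"

text \<open>Restricting a kernel vector to the two entries around \<open>0\<close> is injective, because the transfer
  maps recover all the others; a pair extends around the cycle iff it returns to itself.\<close>

lemma card_cyclic_kernel:
  assumes n: "n > 0"
  shows "card (cyclic_kernel n D) = card {v. transfer n D v = v}"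
proof (rule bij_betw_same_card)
  let ?f = "\<lambda>X. (n - 1 \<in> X, 0 \<in> X)"
  have orbit: "transfer k D (?f X) = ((k + n - 1) mod n \<in> X, k mod n \<in> X)"
    if X: "X \<in> cyclic_kernel n D" and "k \<le> n" for X k
    using that(2)
  proof (induction k)
    case 0
    then show ?case using n by simp
  next
    case (Suc k)
    then have "((k + 1) mod n \<in> X) \<noteq> ((k + n - 1) mod n \<in> X) \<longleftrightarrow> k \<in> D \<and> k \<in> X"
      using X by (simp add: cyclic_kernel_def)
    then show ?case using Suc by (auto simp: transfer_step_def)
  qed
  show "bij_betw ?f (cyclic_kernel n D) {v. transfer n D v = v}"
    unfolding bij_betw_def
  proof (intro conjI equalityI subsetI)
    show "inj_on ?f (cyclic_kernel n D)"
    proof (rule inj_onI)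
      fix X Y assume X: "X \<in> cyclic_kernel n D" and Y: "Y \<in> cyclic_kernel n D" and eq: "?f X = ?f Y"
      have "k \<in> X \<longleftrightarrow> k \<in> Y" if "k < n" for k
        using orbit[OF X, of k] orbit[OF Y, of k] eq that by simp
      then show "X = Y" using X Y unfolding cyclic_kernel_def by blast
    qed
  next
    fix v assume "v \<in> ?f ` cyclic_kernel n D"
    then obtain X where X: "X \<in> cyclic_kernel n D" and "v = ?f X" by blast
    moreover have "(n + n - 1) mod n = n - 1" using n
      by (metis Nat.add_diff_assoc One_nat_def Suc_leI diff_less mod_add_self1 mod_less zero_less_one)
    ultimately show "v \<in> {v. transfer n D v = v}" using orbit[OF X, of n] n by simp
  next
    fix v assume "v \<in> {v. transfer n D v = v}"
    then have v: "transfer n D v = v" by simp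
    define X where "X = {k. k < n \<and> snd (transfer k D v)}"
    have fst_Suc: "fst (transfer (Suc k) D v) = snd (transfer k D v)" for k
      by (simp add: transfer_step_def)
    have pred: "(i + n - 1) mod n \<in> X \<longleftrightarrow> fst (transfer i D v)" if "i < n" for i
    proof (cases i)
      case 0
      have "fst v = snd (transfer (n - 1) D v)" using fst_Suc[of "n - 1"] v n by simp
      then show ?thesis using 0 n by (simp add: X_def)
    next
      case (Suc j)
      then show ?thesis using fst_Suc[of j] that by (simp add: X_def del: transfer.simps)
    qed
    have succ: "(i + 1) mod n \<in> X \<longleftrightarrow> snd (transfer (Suc i) D v)" if "i < n" for i
    proof (cases "Suc i = n")
      case True
      then show ?thesis using v n by (auto simp: X_def simp del: transfer.simps(2))
    next
      case False
      then show ?thesis using that by (simp add: X_def del: transfer.simps)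
    qed
    have "X \<in> cyclic_kernel n D"
      using pred succ by (auto simp: cyclic_kernel_def transfer_step_def X_def)
    moreover have "?f X = v"
      using pred[of 0] n by (auto simp: X_def prod_eq_iff)
    ultimately show "v \<in> ?f ` cyclic_kernel n D" by (intro image_eqI[where x = X]) simp_all
  qed
qed

section \<open>Words in the symmetric group on three letters\<close>

abbreviation S where "S \<equiv> transfer_step False"
abbreviation R where "R \<equiv> transfer_step True"

text \<open>Splitting the diagonals according to their last entry multiplies by \<open>S + R\<close> on the left.\<close>

lemma sum_transfer_Suc:
  "(\<Sum>D\<in>Pow {..<Suc n}. F (transfer (Suc n) D)) =
   (\<Sum>D\<in>Pow {..<n}. F (S \<circ> transfer n D) + F (R \<circ> transfer n D))"
  for F :: "_ \<Rightarrow> 'b :: comm_monoid_add"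
proof -
  have cong: "transfer n D = transfer n D'" if "\<And>i. i < n \<Longrightarrow> i \<in> D \<longleftrightarrow> i \<in> D'" for n D D'
    using that by (induction n) simp_all
  have "inj_on (insert n) (Pow {..<n})"
  proof (rule inj_onI)
    fix D D' assume "D \<in> Pow {..<n}" "D' \<in> Pow {..<n}" "insert n D = insert n D'"
    moreover from this have "n \<notin> D" "n \<notin> D'" by auto
    ultimately show "D = D'" by (simp add: insert_ident)
  qed
  moreover have "Pow {..<n} \<inter> insert n ` Pow {..<n} = {}" by auto
  moreover have "Pow {..<Suc n} = Pow {..<n} \<union> insert n ` Pow {..<n}"
    by (simp add: lessThan_Suc Pow_insert)
  ultimately have "(\<Sum>D\<in>Pow {..<Suc n}. F (transfer (Suc n) D)) =
      (\<Sum>D\<in>Pow {..<n}. F (transfer (Suc n) D)) + (\<Sum>D\<in>Pow {..<n}. F (transfer (Suc n) (insert n D)))"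
    by (simp add: sum.union_disjoint sum.reindex del: transfer.simps)
  also have "(\<Sum>D\<in>Pow {..<n}. F (transfer (Suc n) D)) = (\<Sum>D\<in>Pow {..<n}. F (S \<circ> transfer n D))"
  proof (rule sum.cong)
    fix D assume "D \<in> Pow {..<n}"
    then have "n \<notin> D" by auto
    then show "F (transfer (Suc n) D) = F (S \<circ> transfer n D)" by simp
  qed simp
  also have "(\<Sum>D\<in>Pow {..<n}. F (transfer (Suc n) (insert n D))) = (\<Sum>D\<in>Pow {..<n}. F (R \<circ> transfer n D))"
  proof (rule sum.cong)
    fix D assume "D \<in> Pow {..<n}"
    have "transfer n (insert n D) = transfer n D" by (rule cong) auto
    then show "F (transfer (Suc n) (insert n D)) = F (R \<circ> transfer n D)" by simp
  qed simp
  finally show ?thesis by (simp only: sum.distrib)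
qed

text \<open>The presentation of the symmetric group, oriented so that every word in \<open>S\<close> and \<open>R\<close> rewrites
  to one of the six normal forms \<open>id\<close>, \<open>R\<close>, \<open>R \<circ> R\<close>, \<open>S\<close>, \<open>S \<circ> R\<close>, \<open>S \<circ> (R \<circ> R)\<close>.\<close>

lemma transfer_relations:
  "S \<circ> S = id" "R \<circ> (R \<circ> R) = id" "S \<circ> (S \<circ> g) = g" "R \<circ> (R \<circ> (R \<circ> g)) = g"
  "R \<circ> S = S \<circ> (R \<circ> R)" "R \<circ> (S \<circ> g) = S \<circ> (R \<circ> (R \<circ> g))"
proof -
  have "S (S v) = v" "R (R (R v)) = v" "R (S v) = S (R (R v))" for v
    by (cases v; cases "fst v"; cases "snd v"; simp add: transfer_step_def)+
  then show
    "S \<circ> S = id" "R \<circ> (R \<circ> R) = id" "S \<circ> (S \<circ> g) = g" "R \<circ> (R \<circ> (R \<circ> g)) = g"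
    "R \<circ> S = S \<circ> (R \<circ> R)" "R \<circ> (S \<circ> g) = S \<circ> (R \<circ> (R \<circ> g))"
    by (simp_all add: fun_eq_iff)
qed

text \<open>Left multiplication by \<open>S + R\<close> doubles the sum \<open>\<Sigma>\<close> of all six elements.  It turns the
  remainder \<open>R + S\<close> of odd \<open>n\<close> into the remainder of even \<open>n\<close>, and that one back into \<open>\<Sigma> + R + S\<close>.
  The factor of \<open>\<Sigma>\<close> is then forced by the total number \<open>2 ^ n\<close> of words.  Letting \<open>F\<close> be
  arbitrary expresses an identity in the group algebra and lets the induction hypothesis be
  applied to \<open>F (S \<circ> g) + F (R \<circ> g)\<close>.\<close>

lemma sum_transfer:
  fixes F :: "(bool \<times> bool \<Rightarrow> bool \<times> bool) \<Rightarrow> rat poly"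
  assumes "n > 0"
  shows "(\<Sum>D\<in>Pow {..<n}. F (transfer n D)) =
    smult ((2 ^ n - (if odd n then 2 else 4)) / 6)
      (F id + F R + F (R \<circ> R) + F S + F (S \<circ> R) + F (S \<circ> (R \<circ> R))) +
    (if odd n then F R + F S else F id + F (R \<circ> R) + F (S \<circ> R) + F (S \<circ> (R \<circ> R)))"
  using assms
proof (induction n arbitrary: F rule: nat_induct_non_zero)
  case 1
  then show ?case by (simp add: sum_transfer_Suc[of F 0, simplified] lessThan_Suc Pow_insert)
next
  case (Suc n)
  let ?c = "\<lambda>n. (2 ^ n - (if odd n then 2 else 4)) / 6 :: rat"
  have coeff: "?c (Suc n) = 2 * ?c n + (if odd n then 0 else 1)" by (simp add: field_simps)
  have "(\<Sum>D\<in>Pow {..<Suc n}. F (transfer (Suc n) D)) =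
      (\<Sum>D\<in>Pow {..<n}. F (S \<circ> transfer n D) + F (R \<circ> transfer n D))"
    by (rule sum_transfer_Suc)
  also note Suc.IH[of "\<lambda>g. F (S \<circ> g) + F (R \<circ> g)"]
  finally have step: "(\<Sum>D\<in>Pow {..<Suc n}. F (transfer (Suc n) D)) =
    smult (?c n) (F S + F R + (F (S \<circ> R) + F (R \<circ> R)) + (F (S \<circ> (R \<circ> R)) + F id) + (F id + F (S \<circ> (R \<circ> R)))
       + (F R + F S) + (F (R \<circ> R) + F (S \<circ> R))) +
    (if odd n then F (S \<circ> R) + F (R \<circ> R) + (F id + F (S \<circ> (R \<circ> R)))
     else F S + F R + (F (S \<circ> (R \<circ> R)) + F id) + (F R + F S) + (F (R \<circ> R) + F (S \<circ> R)))"
    by (simp only: transfer_relations comp_id)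
  \<comment> \<open>The six elements occur twice, once from \<open>S\<close> and once from \<open>R\<close>; the letters stand for the
    values of \<open>F\<close> in the order in which they first appear above, \<open>a\<close> for \<open>F S\<close> up to \<open>g\<close> for \<open>F id\<close>.\<close>
  have twice: "smult c (a + b + (d + e) + (f + g) + (g + f) + (b + a) + (e + d)) =
      smult (2 * c) (g + b + e + a + d + f)"
    for c :: rat and a b d e f g :: "rat poly"
  proof -
    have "a + b + (d + e) + (f + g) + (g + f) + (b + a) + (e + d) =
        (g + b + e + a + d + f) + (g + b + e + a + d + f)"
      by (simp only: add_ac)
    then show ?thesis by (simp only: mult_2 smult_add_left smult_add_right)
  qed
  show ?case
  proof (cases "odd n")
    case True
    then have c: "?c (Suc n) = 2 * ?c n" using coeff by simp
    show ?thesis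
      unfolding step c twice using True by (simp only: even_Suc if_True if_False not_not not_False_eq_True not_True_eq_False add_ac)
  next
    case False
    then have c: "?c (Suc n) = 2 * ?c n + 1" using coeff by simp
    have ev: "even n = True" using False by simp
    show ?thesis
      unfolding step c twice by (simp only: ev even_Suc not_True_eq_False if_True if_False not_not smult_add_left smult_1_left not_False_eq_True add_ac)
  qed
qed

lemma cycle_graph_adjacent_iff:
  assumes n: "n \<ge> 3" and i: "i < n" and j: "j < n"
  shows "{i, j} \<in> snd (cycle_graph n) \<longleftrightarrow> j = (i + 1) mod n \<or> j = (i + n - 1) mod n"
proof -
  have "{i, j} \<in> snd (cycle_graph n) \<longleftrightarrow> j = (i + 1) mod n \<or> i = (j + 1) mod n"
    using i j by (auto simp: cycle_graph_def doubleton_eq_iff)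
  moreover have "i = (j + 1) mod n \<longleftrightarrow> j = (i + n - 1) mod n"
    using n i j by (cases i) (auto simp: mod_if split: if_splits)
  ultimately show ?thesis by simp
qed

text \<open>For \<open>n \<ge> 3\<close> the two neighbours of a vertex in the cycle are distinct, so the parity of the number
  of neighbours in \<open>h\<close> is the exclusive disjunction in \<open>cyclic_kernel\<close>.\<close>

lemma card_cycle_loop_kernel:
  assumes n: "n \<ge> 3" and phi: "bij_betw \<phi> V {..<n}" and T: "T \<subseteq> V"
    and adj: "\<And>u v. u \<in> V \<Longrightarrow> v \<in> V \<Longrightarrow> adj u v \<longleftrightarrow> {\<phi> u, \<phi> v} \<in> snd (cycle_graph n)"
  shows "card {h \<in> Pow V. \<forall>e\<in>V. odd (card {f \<in> h. adj e f}) \<longleftrightarrow> e \<in> T \<and> e \<in> h} =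
    card (cyclic_kernel n (\<phi> ` T))"
proof (rule bij_betw_same_card)
  have inj: "inj_on \<phi> V" and im: "\<phi> ` V = {..<n}" using phi by (auto simp: bij_betw_def)
  have lt: "\<phi> v < n" if "v \<in> V" for v using im that by auto
  have mem: "\<phi> v \<in> \<phi> ` h \<longleftrightarrow> v \<in> h" if "v \<in> V" "h \<subseteq> V" for v h
    using inj_on_image_mem_iff[OF inj that] .
  have local: "odd (card {f \<in> h. adj e f}) \<longleftrightarrow>
      ((\<phi> e + 1) mod n \<in> \<phi> ` h) \<noteq> ((\<phi> e + n - 1) mod n \<in> \<phi> ` h)"
    if h: "h \<subseteq> V" and e: "e \<in> V" for h e
  proof -
    let ?s = "(\<phi> e + 1) mod n" and ?t = "(\<phi> e + n - 1) mod n"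
    have s_eq: "?s = (if \<phi> e = n - 1 then 0 else \<phi> e + 1)" using lt[OF e] by simp
    have t_eq: "?t = (if \<phi> e = 0 then n - 1 else \<phi> e - 1)"
    proof (cases "\<phi> e")
      case (Suc m)
      then have "\<phi> e + n - 1 = m + n" by simp
      then show ?thesis using Suc lt[OF e] by simp
    qed (use n in simp)
    have ne: "?s \<noteq> ?t" unfolding s_eq t_eq using n by auto
    have "f \<in> V \<Longrightarrow> adj e f \<longleftrightarrow> \<phi> f = ?s \<or> \<phi> f = ?t" for f
      using adj[OF e] cycle_graph_adjacent_iff[OF n lt[OF e] lt] by simp
    then have neighbours: "\<phi> ` {f \<in> h. adj e f} = {j \<in> {?s, ?t}. j \<in> \<phi> ` h}" using h by auto
    have card: "card {f \<in> h. adj e f} = card (\<phi> ` {f \<in> h. adj e f})"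
      using h by (intro card_image[symmetric] inj_on_subset[OF inj]) auto
    have split: "{j \<in> {s, t}. j \<in> X} = (if s \<in> X then {s} else {}) \<union> (if t \<in> X then {t} else {})"
      for s t :: nat and X by auto
    have parity: "odd (card ((if P then {?s} else {}) \<union> (if Q then {?t} else {}))) \<longleftrightarrow> P \<noteq> Q" for P Q
      using ne by auto
    show ?thesis unfolding card neighbours split parity ..
  qed
  have kernel_iff: "(\<forall>e\<in>V. odd (card {f \<in> h. adj e f}) \<longleftrightarrow> e \<in> T \<and> e \<in> h) \<longleftrightarrow>
      \<phi> ` h \<in> cyclic_kernel n (\<phi> ` T)" if h: "h \<subseteq> V" for h
  proof -
    have "\<phi> ` h \<in> cyclic_kernel n (\<phi> ` T) \<longleftrightarrow> (\<forall>i\<in>\<phi> ` V.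
      (((i + 1) mod n \<in> \<phi> ` h) \<noteq> ((i + n - 1) mod n \<in> \<phi> ` h)) \<longleftrightarrow> i \<in> \<phi> ` T \<and> i \<in> \<phi> ` h)"
    proof -
      have "\<phi> ` h \<subseteq> {..<n}" using h im by blast
      then show ?thesis unfolding im cyclic_kernel_def by (simp add: Ball_def)
    qed
    also have "\<dots> \<longleftrightarrow> (\<forall>e\<in>V. odd (card {f \<in> h. adj e f}) \<longleftrightarrow> e \<in> T \<and> e \<in> h)"
      using local[OF h] mem h T by simp
    finally show ?thesis by simp
  qed
  show "bij_betw ((`) \<phi>) {h \<in> Pow V. \<forall>e\<in>V. odd (card {f \<in> h. adj e f}) \<longleftrightarrow> e \<in> T \<and> e \<in> h}
      (cyclic_kernel n (\<phi> ` T))"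
  proof -
    have pow: "bij_betw ((`) \<phi>) (Pow V) (Pow {..<n})" using phi by (rule bij_betw_Pow)
    have image: "(`) \<phi> ` {h \<in> Pow V. \<phi> ` h \<in> cyclic_kernel n (\<phi> ` T)} = cyclic_kernel n (\<phi> ` T)"
    proof -
      have "X \<in> (`) \<phi> ` Pow V" if "X \<in> cyclic_kernel n (\<phi> ` T)" for X
        using that bij_betw_imp_surj_on[OF pow] by (simp add: cyclic_kernel_def)
      then show ?thesis by blast
    qed
    have "bij_betw ((`) \<phi>) {h \<in> Pow V. \<phi> ` h \<in> cyclic_kernel n (\<phi> ` T)} (cyclic_kernel n (\<phi> ` T))"
      by (rule bij_betw_subset[OF pow _ image]) blast
    moreover have "{h \<in> Pow V. \<forall>e\<in>V. odd (card {f \<in> h. adj e f}) \<longleftrightarrow> e \<in> T \<and> e \<in> h} =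
        {h \<in> Pow V. \<phi> ` h \<in> cyclic_kernel n (\<phi> ` T)}"
      using kernel_iff by auto
    ultimately show ?thesis by simp
  qed
qed

lemma card_fixed_points:
  "card {v. id v = (v :: bool \<times> bool)} = 4"
  "card {v. S v = v} = 2" "card {v. (S \<circ> R) v = v} = 2" "card {v. (S \<circ> (R \<circ> R)) v = v} = 2"
  "card {v. R v = v} = 1" "card {v. (R \<circ> R) v = v} = 1"
proof -
  have "{v. S v = v} = {(False, False), (True, True)}"
    "{v. (S \<circ> R) v = v} = {(False, False), (True, False)}"
    "{v. (S \<circ> (R \<circ> R)) v = v} = {(False, False), (False, True)}"
    "{v. R v = v} = {(False, False)}" "{v. (R \<circ> R) v = v} = {(False, False)}"
    by (auto simp: transfer_step_def)
  then show "card {v. S v = v} = 2" "card {v. (S \<circ> R) v = v} = 2" "card {v. (S \<circ> (R \<circ> R)) v = v} = 2"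
    "card {v. R v = v} = 1" "card {v. (R \<circ> R) v = v} = 1" by simp_all
  have all: "{v. id v = (v :: bool \<times> bool)} = {(False, False), (False, True), (True, False), (True, True)}"
    by auto
  show "card {v. id v = (v :: bool \<times> bool)} = 4" unfolding all by simp
qed

text \<open>The number of fixed vectors is \<open>2 ^ k\<close> for the dimension \<open>k\<close> of the kernel, which \<open>THE\<close> reads
  off.\<close>

lemma sum_monom_transfer:
  assumes "n > 0"
  shows "(\<Sum>D\<in>Pow {..<n}. monom (1 :: rat) (n - (THE k. 2 ^ k = card {v. transfer n D v = v}))) =
    (if odd n then
       monom ((2 ^ (n - 1) - 1) / 3) (n - 2) + monom (2 ^ (n - 1)) (n - 1)
         + monom ((2 ^ n + 1) / 3) n
     else
       monom ((2 ^ (n - 1) + 1) / 3) (n - 2) + monom (2 ^ (n - 1)) (n - 1)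
         + monom ((2 ^ n - 1) / 3) n)"
proof -
  define F :: "(bool \<times> bool \<Rightarrow> bool \<times> bool) \<Rightarrow> rat poly" where
    "F g = monom 1 (n - (THE k. 2 ^ k = card {v. g v = v}))" for g
  have log: "(THE k. 2 ^ k = (2 :: nat) ^ m) = m" for m
    by (rule the_equality) (auto simp: power_inject_exp)
  have F: "F g = monom 1 (n - m)" if "card {v. g v = v} = 2 ^ m" for g m
    unfolding F_def that log ..
  define X Y Z where XYZ: "X = monom (1 :: rat) (n - 2)" "Y = monom (1 :: rat) (n - 1)" "Z = monom (1 :: rat) n"
  have FX: "F id = X" using F[of id 2] card_fixed_points(1) by (simp add: XYZ)
  have FY: "F S = Y" "F (S \<circ> R) = Y" "F (S \<circ> (R \<circ> R)) = Y"
    using F[of S 1] F[of "S \<circ> R" 1] F[of "S \<circ> (R \<circ> R)" 1] card_fixed_points(2-4)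
    unfolding XYZ by (simp_all only: power_one_right)
  have FZ: "F R = Z" "F (R \<circ> R) = Z"
    using F[of R 0] F[of "R \<circ> R" 0] card_fixed_points(5,6)
    unfolding XYZ by (simp_all only: power_0 diff_zero)
  define c :: rat where "c = (2 ^ n - (if odd n then 2 else 4)) / 6"
  have pow: "(2::rat) ^ n = 2 * 2 ^ (n - 1)" using assms by (cases n) simp_all
  have sum: "(\<Sum>D\<in>Pow {..<n}. F (transfer n D)) =
      smult c (X + Z + Z + Y + Y + Y) + (if odd n then Z + Y else X + Z + Y + Y)"
    unfolding sum_transfer[OF assms] c_def FX FY FZ ..
  have mon: "monom d (n - 2) = smult d X" "monom d (n - 1) = smult d Y" "monom d n = smult d Z" for d
    by (simp_all add: XYZ smult_monom)
  have collect: "smult c (X + Z + Z + Y + Y + Y) + (Z + Y) = smult c X + smult (c + c + c + 1) Y + smult (c + c + 1) Z"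
    "smult c (X + Z + Z + Y + Y + Y) + (X + Z + Y + Y) = smult (c + 1) X + smult (c + c + c + 1 + 1) Y + smult (c + c + 1) Z"
    by (simp_all only: smult_add_left smult_add_right smult_1_left add_ac)
  show ?thesis
  proof (cases "odd n")
    case True
    then have coeffs: "c + c + c + 1 = 2 ^ (n - 1)" "c + c + 1 = (2 ^ n + 1) / 3" "c = (2 ^ (n - 1) - 1) / 3"
      by (simp_all add: c_def pow field_simps)
    have "(\<Sum>D\<in>Pow {..<n}. F (transfer n D)) = smult c X + smult (c + c + c + 1) Y + smult (c + c + 1) Z"
      unfolding sum collect(1)[symmetric] using True by simp
    then show ?thesis
      unfolding coeffs(1,2) F_def mon unfolding coeffs(3) using True by simp
  next
    case False
    then have coeffs: "c + c + c + 1 + 1 = 2 ^ (n - 1)" "c + c + 1 = (2 ^ n - 1) / 3" "c + 1 = (2 ^ (n - 1) + 1) / 3"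
      by (simp_all add: c_def pow field_simps)
    have "(\<Sum>D\<in>Pow {..<n}. F (transfer n D)) =
        smult (c + 1) X + smult (c + c + c + 1 + 1) Y + smult (c + c + 1) Z"
      unfolding sum collect(2)[symmetric] using False by simp
    then show ?thesis
      unfolding coeffs F_def mon using False by simp
  qed
qed

section \<open>The partial Petrial polynomial\<close>

theorem theorem3p3:
  fixes B :: "'a ribbon_graph" and n :: nat
  assumes "n \<ge> 3"
    and "bouquet B"
    and "card (edges B) = n"
    and "sgraph_iso (intersection_graph B) (cycle_graph n)"
  shows "partial_petrial_polynomial B =
    (if odd n then
       monom ((2 ^ (n - 1) - 1) / 3) (n - 2) + monom (2 ^ (n - 1)) (n - 1)
         + monom ((2 ^ n + 1) / 3) n
     else
       monom ((2 ^ (n - 1) + 1) / 3) (n - 2) + monom (2 ^ (n - 1)) (n - 1)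
         + monom ((2 ^ n - 1) / 3) n)"
proof -
  have ribbon: "is_ribbon_graph B" using assms(2) by (simp add: bouquet_def)
  have "edges B \<noteq> {}" using assms(1,3) by auto
  then obtain x0 where x0: "x0 \<in> flags B" by (auto simp: edges_eq[OF ribbon])
  have B: "based_bouquet B x0" using assms(2) x0 by (simp add: based_bouquet_def)
  obtain \<phi> where phi: "bij_betw \<phi> (edges B) {..<n}"
    and iso: "\<And>u v. u \<in> edges B \<Longrightarrow> v \<in> edges B \<Longrightarrow>
      {u, v} \<in> snd (intersection_graph B) \<longleftrightarrow> {\<phi> u, \<phi> v} \<in> snd (cycle_graph n)"
    using assms(4) unfolding sgraph_iso_def
    by (auto simp: intersection_graph_def cycle_graph_def)
  have adj: "interlaced B u v \<longleftrightarrow> {\<phi> u, \<phi> v} \<in> snd (cycle_graph n)"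
    if "u \<in> edges B" "v \<in> edges B" for u v
  proof -
    have "{u, v} \<in> snd (intersection_graph B) \<longleftrightarrow> interlaced B u v"
      using that based_bouquet.interlaced_sym[OF B] by (auto simp: intersection_graph_def doubleton_eq_iff)
    then show ?thesis using iso[OF that] by simp
  qed
  \<comment> \<open>The diagonal that belongs to \<open>A\<close>.  As \<open>tw\<close> is an involution, every diagonal arises once.\<close>
  define tw where "tw A = {e \<in> edges B. twisted B e \<noteq> (e \<in> A)}" for A
  have genus: "nat (euler_genus (partial_petrial B A)) =
      n - (THE k. 2 ^ k = card {v. transfer n (\<phi> ` tw A) v = v})" if A: "A \<subseteq> edges B" for A
  proof -
    let ?P = "partial_petrial B A"
    have P: "based_bouquet ?P x0"
      using bouquet_partial_petrial[OF ribbon A assms(2)] x0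
      by (simp add: based_bouquet_def partial_petrial_def)
    have "face_kernel ?P = {h \<in> Pow (edges B). \<forall>e\<in>edges B.
        odd (card {f \<in> h. interlaced B e f}) \<longleftrightarrow> e \<in> tw A \<and> e \<in> h}"
      using based_bouquet.twisted_partial_petrial[OF B A]
      by (auto simp: face_kernel_def edges_partial_petrial[OF ribbon A]
          interlaced_partial_petrial[OF ribbon A] tw_def)
    also have "card \<dots> = card (cyclic_kernel n (\<phi> ` tw A))"
      by (rule card_cycle_loop_kernel[OF assms(1) phi _ adj]) (auto simp: tw_def)
    also have "\<dots> = card {v. transfer n (\<phi> ` tw A) v = v}"
      using assms(1) by (intro card_cyclic_kernel) simp
    finally have faces: "2 ^ num_faces ?P = 2 * card {v. transfer n (\<phi> ` tw A) v = v}"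
      using based_bouquet.two_power_num_faces[OF P] by simp
    then obtain m where m: "num_faces ?P = Suc m" by (cases "num_faces ?P") auto
    then have "card {v. transfer n (\<phi> ` tw A) v = v} = 2 ^ m" using faces by simp
    moreover have "(THE k. 2 ^ k = (2 :: nat) ^ m) = m"
      by (rule the_equality) (auto simp: power_inject_exp)
    ultimately show ?thesis
      using based_bouquet.euler_genus_eq[OF P] m assms(3) by (simp add: edges_partial_petrial[OF ribbon A])
  qed
  have "bij_betw tw (Pow (edges B)) (Pow (edges B))"
    by (rule bij_betw_byWitness[where f' = tw]) (auto simp: tw_def)
  from bij_betw_trans[OF this bij_betw_Pow[OF phi]]
  have bij: "bij_betw (\<lambda>A. \<phi> ` tw A) (Pow (edges B)) (Pow {..<n})" by (simp add: comp_def)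
  have "partial_petrial_polynomial B =
      (\<Sum>A\<in>Pow (edges B). monom 1 (n - (THE k. 2 ^ k = card {v. transfer n (\<phi> ` tw A) v = v})))"
    unfolding partial_petrial_polynomial_def using genus by (intro sum.cong) auto
  also have "\<dots> = (\<Sum>D\<in>Pow {..<n}. monom 1 (n - (THE k. 2 ^ k = card {v. transfer n D v = v})))"
    using sum.reindex_bij_betw[OF bij, of "\<lambda>D. monom 1 (n - (THE k. 2 ^ k = card {v. transfer n D v = v}))"] .
  also note sum_monom_transfer
  finally show ?thesis using assms(1) by simp
qed

end
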